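(* Let $b_{-6}(t,\eta,\xi_1,\dots,\xi_6)$ be the part of $\mathrm{tr}(\sigma_{-6}(\Delta_4^{-1}))$ even in each $\xi_j$, which computes the $a_4$ term of the heat kernel expansion of $D^2$ for the Robertson-Walker metric with scale factor $a(t)$. Perform the change of variables $$u_0=\sin^2\eta,\quad u_1=\xi_1,\quad u_2=\xi_2,\quad u_3=\csc(\eta)\xi_3,\quad u_4=\sec(\eta)\xi_4,\quad u_5=\xi_5,\quad u_6=\xi_6,$$ and write $\alpha=a(t)$, $\alpha_i=a^{(i)}(t)$ for $i=1,\dots,4$, regarded as independent affine variables $\alpha\in\mathbb G_m$, $(\alpha_1,\dots,\alpha_4)\in\mathbb A^4$. Then the form $b_{-6}\,d\eta\wedge\sigma_{\xi,5}$, with $\sigma_{\xi,5}=\sum_{j=1}^6(-1)^{j-1}\xi_j\,d\xi_1\wedge\cdots\wedge\widehat{d\xi_j}\wedge\cdots\wedge d\xi_6$, is a rational differential form $$\Omega=f\,\widetilde\sigma_5$$ in the affine coordinates $(u_0,\dots,u_6)\in\mathbb A^7$, $\alpha\in\mathbb G_m$, $(\alpha_1,\dots,\alpha_4)\in\mathbb A^4$, where $f=f_{(\alpha_1,\alpha_2,\alpha_3,\alpha_4)}(u_0,\dots,u_6,\alpha)$ is a $\mathbb Q$-linear combination of rational functions of the form $$\frac{P(u_0,u_1,\dots,u_6,\alpha,\alpha_1,\alpha_2,\alpha_3,\alpha_4)}{\alpha^{2r}u_0^k(1-u_0)^m\big(u_1^2+\alpha^{-2}(u_2^2+u_3^2+u_4^2)+u_5^2+u_6^2\big)^\ell}$$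 with $P\in\mathbb Q[u_0,\dots,u_6,\alpha,\alpha_1,\dots,\alpha_4]$ and $r,k,m,\ell$ non-negative integers, and $$\widetilde\sigma_5=\frac12\sum_{j=1}^6(-1)^{j-1}u_j\,du_0\wedge du_1\wedge\cdots\wedge\widehat{du_j}\wedge\cdots\wedge du_6.$$ Moreover, for a fixed $\alpha\in\mathbb Q\smallsetminus\{0\}$, the restrictions $\Omega^\alpha_{(\alpha_1,\alpha_2,\alpha_3,\alpha_4)}$, $(\alpha_1,\dots,\alpha_4)\in\mathbb Q^4$, are a four-parameter family of algebraic differential forms on the algebraic variety over $\mathbb Q$ given by the complement in $\mathbb A^7$ of the union of the hyperplanes $H_0=\{u_0=0\}$, $H_1=\{u_0=1\}$ and the hypersurface $\widehat{CZ}_\alpha$ defined by the vanishing of the quadratic form $Q_{\alpha,4}=u_1^2+\alpha^{-2}(u_2^2+u_3^2+u_4^2)+u_5^2+u_6^2$.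
   Context: Setting. Let $a(t)>0$ be a smooth function and consider the (Euclidean) Robertson-Walker metric $ds^2=dt^2+a(t)^2d\sigma^2$, with $d\sigma^2$ the round metric on $\mathbb S^3$, in Hopf coordinates $x=(x_1,x_2,x_3,x_4)=(t,\eta,\phi_1,\phi_2)$, $0<\eta<\pi/2$, $0<\phi_1,\phi_2<2\pi$: $ds^2=dt^2+a(t)^2(d\eta^2+\sin^2\eta\,d\phi_1^2+\cos^2\eta\,d\phi_2^2)$. In a local trivialization of the spinor bundle the Dirac operator $D$ has symbol $q_1+q_0$, with $q_1=\begin{pmatrix}0&A_1\\ B_1&0\end{pmatrix}$, $q_0=\begin{pmatrix}0&A_0\\ B_0&0\end{pmatrix}$ in $2\times2$ blocks, where (with $a=a(t)$) $$A_1=\begin{pmatrix}\frac{i\sec\eta\,\xi_4}{a}-\xi_1&\frac{i\xi_2+\csc\eta\,\xi_3}{a}\\ \frac{i\xi_2-\csc\eta\,\xi_3}{a}&-\xi_1-\frac{i\sec\eta\,\xi_4}{a}\end{pmatrix},\quad B_1=\begin{pmatrix}-\xi_1-\frac{i\sec\eta\,\xi_4}{a}&\frac{-i\xi_2-\csc\eta\,\xi_3}{a}\\ \frac{\csc\eta\,\xi_3-i\xi_2}{a}&\frac{i\sec\eta\,\xi_4}{a}-\xi_1\end{pmatrix},$$ $$A_0=\begin{pmatrix}\frac{3ia'}{2a}&\frac{\cot\eta-\tan\eta}{2a}\\ \frac{\cot\eta-\tan\eta}{2a}&\frac{3ia'}{2a}\end{pmatrix},\quad B_0=\begin{pmatrix}\frac{3ia'}{2a}&\frac{\tan\eta-\cot\eta}{2a}\\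 \frac{\tan\eta-\cot\eta}{2a}&\frac{3ia'}{2a}\end{pmatrix}.$$ The symbol of $D^2$ is $p_2+p_1+p_0$ with $p_2=q_1^2=\big(\xi_1^2+\frac{\xi_2^2+\csc^2\eta\,\xi_3^2+\sec^2\eta\,\xi_4^2}{a^2}\big)I_4$, $p_1=q_0q_1+q_1q_0-i\sum_j\partial_{\xi_j}q_1\,\partial_{x_j}q_1$, $p_0=q_0^2-i\sum_j\partial_{\xi_j}q_1\,\partial_{x_j}q_0$. Parametrix. Let $\Delta_4=D^2\otimes1+1\otimes\Delta_{\mathbb T^2}$, with $\Delta_{\mathbb T^2}$ the flat Laplacian (symbol $\xi_5^2+\xi_6^2$) on $\mathbb T^2=(\mathbb R/\mathbb Z)^2$. The homogeneous terms $\sigma_{-2-N}=\sigma_{-2-N}(\Delta_4^{-1})$ (of order $-2-N$ in $\xi\in\mathbb R^6$) of the symbol of the parametrix are $\sigma_{-2}=(p_2+(\xi_5^2+\xi_6^2)I_4)^{-1}$ and, for $N>0$, $$\sigma_{-2-N}=-\Big(\sum\frac{(-i)^{|\beta|}}{\beta!}(\partial_\xi^\beta\sigma_{-2-j})(\partial_x^\beta p_k)\Big)\sigma_{-2},$$ the sum being over $0\le j<N$, $0\le k\le2$, $\beta\in\mathbb Z_{\ge0}^4$ (derivatives in $\xi_1,\dots,\xi_4$ and $x_1,\dots,x_4$) with $-2-j-|\beta|+k=-N$. The function $b_{-6}$ is obtained from $\mathrm{tr}(\sigma_{-6})$ (a sum of terms, each a monomial in the $\xi_j$ times a function of $(t,\eta)$,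 divided by a power of $\xi_1^2+\frac{\xi_2^2+\csc^2\eta\,\xi_3^2+\sec^2\eta\,\xi_4^2}{a^2}+\xi_5^2+\xi_6^2$) by deleting all terms with an odd power of some $\xi_j$ in the numerator; i.e. it is the part of $\mathrm{tr}(\sigma_{-6})$ that is even in each $\xi_j$. An algebraic differential form on a variety over $\mathbb Q$ means a regular differential form defined over $\mathbb Q$. *)

theory Defs
  imports "HOL-Analysis.Analysis" "HOL-Library.Poly_Mapping"
begin

section \<open>Symbols\<close>

text \<open>A matrix-valued symbol takes \<open>x = (t, \<eta>, \<phi>\<^sub>1, \<phi>\<^sub>2)\<close> and \<open>\<xi>\<close>. In the index type \<open>n\<close> the numerals
  \<open>1, \<dots>, n\<close> are the \<open>n\<close> distinct indices and \<open>n = 0\<close>.\<close>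

type_synonym symb = "real^4 \<Rightarrow> real^6 \<Rightarrow> complex^4^4"

definition d_x :: "nat \<Rightarrow> symb \<Rightarrow> symb" where
  "d_x j F = (\<lambda>x \<xi>. vector_derivative (\<lambda>s. F (x + s *\<^sub>R axis (of_nat j) 1) \<xi>) (at 0))"

definition d_xi :: "nat \<Rightarrow> symb \<Rightarrow> symb" where
  "d_xi j F = (\<lambda>x \<xi>. vector_derivative (\<lambda>s. F x (\<xi> + s *\<^sub>R axis (of_nat j) 1)) (at 0))"

definition D_x :: "nat^4 \<Rightarrow> symb \<Rightarrow> symb" where
  "D_x \<beta> F = (d_x 1 ^^ (\<beta>$1)) ((d_x 2 ^^ (\<beta>$2)) ((d_x 3 ^^ (\<beta>$3)) ((d_x 4 ^^ (\<beta>$4)) F)))"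

definition D_xi :: "nat^4 \<Rightarrow> symb \<Rightarrow> symb" where
  "D_xi \<beta> F = (d_xi 1 ^^ (\<beta>$1)) ((d_xi 2 ^^ (\<beta>$2)) ((d_xi 3 ^^ (\<beta>$3)) ((d_xi 4 ^^ (\<beta>$4)) F)))"

definition mi_size :: "nat^4 \<Rightarrow> nat" where
  "mi_size \<beta> = (\<Sum>i\<in>UNIV. \<beta>$i)"

definition mi_fact :: "nat^4 \<Rightarrow> complex" where
  "mi_fact \<beta> = (\<Prod>i\<in>UNIV. fact (\<beta>$i))"

definition offdiag :: "complex^2^2 \<Rightarrow> complex^2^2 \<Rightarrow> complex^4^4" where
  "offdiag A B = vector
     [vector [0, 0, A$1$1, A$1$2],
      vector [0, 0, A$2$1, A$2$2],
      vector [B$1$1, B$1$2, 0, 0],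
      vector [B$2$1, B$2$2, 0, 0]]"

definition A1 :: "(real \<Rightarrow> real) \<Rightarrow> real^4 \<Rightarrow> real^6 \<Rightarrow> complex^2^2" where
  "A1 a x \<xi> = (let al = of_real (a (x$1)); csc = of_real (1 / sin (x$2)); sec = of_real (1 / cos (x$2));
      y1 = of_real (\<xi>$1); y2 = of_real (\<xi>$2); y3 = of_real (\<xi>$3); y4 = of_real (\<xi>$4) in vector
     [vector [\<i> * sec * y4 / al - y1, (\<i> * y2 + csc * y3) / al],
      vector [(\<i> * y2 - csc * y3) / al, - y1 - \<i> * sec * y4 / al]])"

definition B1 :: "(real \<Rightarrow> real) \<Rightarrow> real^4 \<Rightarrow> real^6 \<Rightarrow> complex^2^2" where
  "B1 a x \<xi> = (let al = of_real (a (x$1)); csc = of_real (1 / sin (x$2)); sec = of_real (1 / cos (x$2));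
      y1 = of_real (\<xi>$1); y2 = of_real (\<xi>$2); y3 = of_real (\<xi>$3); y4 = of_real (\<xi>$4) in vector
     [vector [- y1 - \<i> * sec * y4 / al, (- \<i> * y2 - csc * y3) / al],
      vector [(csc * y3 - \<i> * y2) / al, \<i> * sec * y4 / al - y1]])"

definition A0 :: "(real \<Rightarrow> real) \<Rightarrow> real^4 \<Rightarrow> complex^2^2" where
  "A0 a x = (let al = of_real (a (x$1)); al' = of_real (deriv a (x$1));
      ct = of_real (cot (x$2)); tn = of_real (tan (x$2)) in vector
     [vector [3 * \<i> * al' / (2 * al), (ct - tn) / (2 * al)],
      vector [(ct - tn) / (2 * al), 3 * \<i> * al' / (2 * al)]])"

definition B0 :: "(real \<Rightarrow> real) \<Rightarrow> real^4 \<Rightarrow> complex^2^2" where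
  "B0 a x = (let al = of_real (a (x$1)); al' = of_real (deriv a (x$1));
      ct = of_real (cot (x$2)); tn = of_real (tan (x$2)) in vector
     [vector [3 * \<i> * al' / (2 * al), (tn - ct) / (2 * al)],
      vector [(tn - ct) / (2 * al), 3 * \<i> * al' / (2 * al)]])"

definition q1 :: "(real \<Rightarrow> real) \<Rightarrow> symb" where
  "q1 a x \<xi> = offdiag (A1 a x \<xi>) (B1 a x \<xi>)"

definition q0 :: "(real \<Rightarrow> real) \<Rightarrow> symb" where
  "q0 a x \<xi> = offdiag (A0 a x) (B0 a x)"

text \<open>Multiplication of a matrix by the scalar \<open>c\<close> is written \<open>mat c ** _\<close>, since \<open>c * _\<close> would be
  componentwise.\<close>

definition p2 :: "(real \<Rightarrow> real) \<Rightarrow> symb" where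
  "p2 a x \<xi> = q1 a x \<xi> ** q1 a x \<xi>"

definition p1 :: "(real \<Rightarrow> real) \<Rightarrow> symb" where
  "p1 a x \<xi> = q0 a x \<xi> ** q1 a x \<xi> + q1 a x \<xi> ** q0 a x \<xi>
     - mat \<i> ** (\<Sum>j=1..4. d_xi j (q1 a) x \<xi> ** d_x j (q1 a) x \<xi>)"

definition p0 :: "(real \<Rightarrow> real) \<Rightarrow> symb" where
  "p0 a x \<xi> = q0 a x \<xi> ** q0 a x \<xi>
     - mat \<i> ** (\<Sum>j=1..4. d_xi j (q1 a) x \<xi> ** d_x j (q0 a) x \<xi>)"

definition p_symbol :: "(real \<Rightarrow> real) \<Rightarrow> nat \<Rightarrow> symb" where
  "p_symbol a k = (if k = 0 then p0 a else if k = 1 then p1 a else p2 a)"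

text \<open>\<open>sigma a N\<close> is \<open>\<sigma>\<^bsub>-2-N\<^esub>(\<Delta>\<^sub>4\<^sup>-\<^sup>1)\<close>.\<close>

fun sigma :: "(real \<Rightarrow> real) \<Rightarrow> nat \<Rightarrow> symb" where
  "sigma a 0 = (\<lambda>x \<xi>. matrix_inv (p2 a x \<xi> + mat (of_real ((\<xi>$5)\<^sup>2 + (\<xi>$6)\<^sup>2))))"
| "sigma a (Suc M) = (\<lambda>x \<xi>. - ((\<Sum>j<Suc M. \<Sum>k\<le>2.
      \<Sum>\<beta> | - 2 - int j - int (mi_size \<beta>) + int k = - int (Suc M).
        mat ((- \<i>) ^ mi_size \<beta> / mi_fact \<beta>) **
          (D_xi \<beta> (sigma a j) x \<xi> ** D_x \<beta> (p_symbol a k) x \<xi>)) ** sigma a 0 x \<xi>))"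

text \<open>The part of a function that is even in \<open>\<xi>\<^sub>j\<close> is the projection along the part odd in \<open>\<xi>\<^sub>j\<close>; the
  lemma \<open>even_part_term\<close> below confirms that composing these deletes exactly the terms with an odd power.\<close>

definition flip :: "6 \<Rightarrow> real^6 \<Rightarrow> real^6" where
  "flip j \<xi> = (\<chi> i. if i = j then - \<xi>$i else \<xi>$i)"

definition even_in :: "6 \<Rightarrow> (real^6 \<Rightarrow> complex) \<Rightarrow> real^6 \<Rightarrow> complex" where
  "even_in j F \<xi> = (F \<xi> + F (flip j \<xi>)) / 2"

definition even_part :: "(real^6 \<Rightarrow> complex) \<Rightarrow> real^6 \<Rightarrow> complex" where
  "even_part F = foldr even_in [1, 2, 3, 4, 5, 6] F"

definition b6 :: "(real \<Rightarrow> real) \<Rightarrow> real^4 \<Rightarrow> real^6 \<Rightarrow> complex" where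
  "b6 a x = even_part (\<lambda>\<xi>. trace (sigma a 4 x \<xi>))"


section \<open>Polynomials with rational coefficients and varieties over the rationals\<close>

type_synonym 'v qpoly = "('v \<Rightarrow>\<^sub>0 nat) \<Rightarrow>\<^sub>0 rat"

definition qeval :: "('v \<Rightarrow> complex) \<Rightarrow> 'v qpoly \<Rightarrow> complex" where
  "qeval z P = (\<Sum>m\<in>Poly_Mapping.keys P. of_rat (Poly_Mapping.lookup P m) *
     (\<Prod>i\<in>Poly_Mapping.keys m. z i ^ Poly_Mapping.lookup m i))"

text \<open>Open subvarieties of affine space over the rationals are represented by their sets of complex
  points. Rational points would not suffice: denominators could vanish at no rational point of the
  set without being units. Since the complex numbers have infinite transcendence degree, every
  scheme-theoretic point lies under a complex one.\<close>

definition zariski_open_over_Q :: "(complex^'n) set \<Rightarrow> bool" where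
  "zariski_open_over_Q U \<longleftrightarrow> (\<exists>S :: 'n qpoly set. U = {u. \<exists>P\<in>S. qeval (($) u) P \<noteq> 0})"

definition regular_over_Q :: "(complex^'n) set \<Rightarrow> (complex^'n \<Rightarrow> complex) \<Rightarrow> bool" where
  "regular_over_Q U f \<longleftrightarrow> (\<forall>p\<in>U. \<exists>P G :: 'n qpoly. qeval (($) p) G \<noteq> 0 \<and>
     (\<forall>q\<in>U. qeval (($) q) G \<noteq> 0 \<longrightarrow> f q = qeval (($) q) P / qeval (($) q) G))"


section \<open>Differential forms\<close>

text \<open>A \<open>k\<close>-form sends a point and tangent vectors \<open>v 0, \<dots>, v (k - 1)\<close> to a scalar; the values of
  \<open>v\<close> beyond these are ignored. The wedge product of one-forms is \<open>det (\<theta>\<^sub>i (v j))\<close>.\<close>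

type_synonym 'a form = "'a \<Rightarrow> (nat \<Rightarrow> 'a) \<Rightarrow> complex"

definition wedge :: "('a \<Rightarrow> complex) list \<Rightarrow> (nat \<Rightarrow> 'a) \<Rightarrow> complex" where
  "wedge \<theta>s v = (\<Sum>\<pi> | \<pi> permutes {..<length \<theta>s}.
     of_int (sign \<pi>) * (\<Prod>i<length \<theta>s. (\<theta>s ! i) (v (\<pi> i))))"

definition pullback :: "('a::real_normed_vector \<Rightarrow> 'b::real_normed_vector) \<Rightarrow> 'b form \<Rightarrow> 'a form" where
  "pullback \<Phi> \<omega> p v = \<omega> (\<Phi> p) (\<lambda>i. frechet_derivative \<Phi> (at p) (v i))"

definition algebraic_form_over_Q :: "nat \<Rightarrow> (complex^'n) set \<Rightarrow> (complex^'n) form \<Rightarrow> bool" where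
  "algebraic_form_over_Q k U \<omega> \<longleftrightarrow> zariski_open_over_Q U \<and>
     (\<exists>F :: 'n list \<Rightarrow> complex^'n \<Rightarrow> complex.
        (\<forall>I. regular_over_Q U (F I)) \<and>
        (\<forall>u\<in>U. \<forall>v. \<omega> u v = (\<Sum>I | length I = k. F I u * wedge (map (\<lambda>i w. w $ i) I) v)))"


section \<open>The change of variables\<close>

text \<open>\<open>d\<eta> \<and> \<sigma>\<^bsub>\<xi>,5\<^esub>\<close> on \<open>(x, \<xi>)\<close>-space.\<close>

definition deta_sigma5 :: "((real^4) \<times> (real^6)) form" where
  "deta_sigma5 p v = (\<Sum>j=1..6. (-1) ^ (j - 1) * of_real (snd p $ of_nat j) *
     wedge ((\<lambda>w. of_real (fst w $ 2)) # map (\<lambda>i w. of_real (snd w $ of_nat i)) (remove1 j [1..<7])) v)"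

text \<open>A point of \<open>\<bbbA>\<^sup>7 \<times> \<bbbG>\<^sub>m \<times> \<bbbA>\<^sup>4\<close> is \<open>(u, \<alpha>, (\<alpha>\<^sub>1, \<dots>, \<alpha>\<^sub>4))\<close> with \<open>\<alpha> \<noteq> 0\<close>, and \<open>u\<close> is indexed by \<open>0, \<dots>, 6\<close>.\<close>

type_synonym rw_point = "(complex^7) \<times> complex \<times> (complex^4)"

datatype rw_var = VarU 7 | VarAlpha | VarAlphaD 4

fun rw_coord :: "rw_point \<Rightarrow> rw_var \<Rightarrow> complex" where
  "rw_coord (u, \<alpha>, \<alpha>s) (VarU i) = u $ i"
| "rw_coord (u, \<alpha>, \<alpha>s) VarAlpha = \<alpha>"
| "rw_coord (u, \<alpha>, \<alpha>s) (VarAlphaD i) = \<alpha>s $ i"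

definition Q4 :: "complex \<Rightarrow> complex^7 \<Rightarrow> complex" where
  "Q4 \<alpha> u = (u$1)\<^sup>2 + ((u$2)\<^sup>2 + (u$3)\<^sup>2 + (u$4)\<^sup>2) / \<alpha>\<^sup>2 + (u$5)\<^sup>2 + (u$6)\<^sup>2"

definition H0 :: "(complex^7) set" where
  "H0 = {u. u$0 = 0}"

definition H1 :: "(complex^7) set" where
  "H1 = {u. u$0 = 1}"

definition CZ :: "complex \<Rightarrow> (complex^7) set" where
  "CZ \<alpha> = {u. Q4 \<alpha> u = 0}"

text \<open>The coefficient is only constrained where all the denominators are non-zero.\<close>

definition is_rw_coefficient :: "(rw_point \<Rightarrow> complex) \<Rightarrow> bool" where
  "is_rw_coefficient f \<longleftrightarrow> (\<exists>(n::nat) (c :: nat \<Rightarrow> rat) (P :: nat \<Rightarrow> rw_var qpoly) r k m l.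
     \<forall>u \<alpha> \<alpha>s. \<alpha> \<noteq> 0 \<and> u \<notin> H0 \<union> H1 \<union> CZ \<alpha> \<longrightarrow>
       f (u, \<alpha>, \<alpha>s) = (\<Sum>i<n. of_rat (c i) *
         (qeval (rw_coord (u, \<alpha>, \<alpha>s)) (P i) /
           (\<alpha> ^ (2 * r i) * (u$0) ^ k i * (1 - u$0) ^ m i * Q4 \<alpha> u ^ l i))))"

definition sigma5_tilde :: "rw_point form" where
  "sigma5_tilde z v = 1/2 * (\<Sum>j=1..6. (-1) ^ (j - 1) * fst z $ of_nat j *
     wedge (map (\<lambda>i w. fst w $ of_nat i) (remove1 j [0..<7])) v)"

definition Omega :: "(rw_point \<Rightarrow> complex) \<Rightarrow> rw_point form" where
  "Omega f z v = f z * sigma5_tilde z v"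

definition chart :: "(real \<Rightarrow> real) \<Rightarrow> (real^4) \<times> (real^6) \<Rightarrow> rw_point" where
  "chart a = (\<lambda>(x, \<xi>).
     (\<chi> i. of_real
        (if i = 0 then (sin (x$2))\<^sup>2
         else if i = 1 then \<xi>$1
         else if i = 2 then \<xi>$2
         else if i = 3 then \<xi>$3 / sin (x$2)
         else if i = 4 then \<xi>$4 / cos (x$2)
         else if i = 5 then \<xi>$5
         else \<xi>$6),
      of_real (a (x$1)),
      \<chi> i. of_real
        (if i = 1 then deriv a (x$1)
         else if i = 2 then (deriv ^^ 2) a (x$1)
         else if i = 3 then (deriv ^^ 3) a (x$1)
         else (deriv ^^ 4) a (x$1))))"

definition slice :: "rat \<Rightarrow> rat^4 \<Rightarrow> complex^7 \<Rightarrow> rw_point" where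
  "slice \<alpha> \<alpha>s u = (u, of_rat \<alpha>, \<chi> i. of_rat (\<alpha>s $ i))"

definition smooth_on_open :: "real set \<Rightarrow> (real \<Rightarrow> real) \<Rightarrow> bool" where
  "smooth_on_open T a \<longleftrightarrow> open T \<and> (\<forall>n. \<forall>t\<in>T. (deriv ^^ n) a differentiable (at t))"


section \<open>Consistency checks\<close>

lemma vector_4_nth:
  "(vector [x, y, z, w] :: 'a::zero^4) $ 1 = x"
  "(vector [x, y, z, w] :: 'a::zero^4) $ 2 = y"
  "(vector [x, y, z, w] :: 'a::zero^4) $ 3 = z"
  "(vector [x, y, z, w] :: 'a::zero^4) $ 4 = w"
  unfolding vector_def by simp_all

lemma p2_eq:
  "p2 a x \<xi> = mat (of_real ((\<xi>$1)\<^sup>2 +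
     ((\<xi>$2)\<^sup>2 + (1 / sin (x$2))\<^sup>2 * (\<xi>$3)\<^sup>2 + (1 / cos (x$2))\<^sup>2 * (\<xi>$4)\<^sup>2) / (a (x$1))\<^sup>2))"
  unfolding p2_def q1_def offdiag_def A1_def B1_def Let_def
  apply (simp add: vec_eq_iff forall_4 matrix_matrix_mult_def sum_4 vector_4_nth mat_def)
  apply (cases "a (x$1) = 0"; cases "sin (x$2) = 0"; cases "cos (x$2) = 0")
         apply (auto simp: field_simps power2_eq_square complex_eq_iff)
  done

lemma finite_multi_indices: "finite {\<beta> :: nat^4. mi_size \<beta> = s}"
proof (rule finite_subset)
  show "{\<beta> :: nat^4. mi_size \<beta> = s} \<subseteq> vec_lambda ` (UNIV \<rightarrow>\<^sub>E {..s})"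
  proof
    fix \<beta> :: "nat^4" assume b: "\<beta> \<in> {\<beta>. mi_size \<beta> = s}"
    have "\<beta> $ i \<le> s" for i
      using b member_le_sum[of i UNIV "($) \<beta>"] by (simp add: mi_size_def)
    then have "($) \<beta> \<in> UNIV \<rightarrow>\<^sub>E {..s}" by auto
    then show "\<beta> \<in> vec_lambda ` (UNIV \<rightarrow>\<^sub>E {..s})"
      by (metis imageI vec_nth_inverse)
  qed
  show "finite (vec_lambda ` (UNIV \<rightarrow>\<^sub>E {..s}) :: (nat^4) set)"
    by (intro finite_imageI finite_PiE) auto
qed

text \<open>On a monomial times a function of the \<open>\<xi>\<^sub>j\<^sup>2\<close>, \<open>even_part\<close> is the identity or zero.\<close>

lemma even_in_term:
  assumes "\<And>j \<xi>. G (flip j \<xi>) = G \<xi>"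
  shows "even_in j (\<lambda>\<xi>. c * (\<Prod>i\<in>UNIV. of_real (\<xi>$i) ^ e i) * G \<xi>) =
    (if even (e j) then (\<lambda>\<xi>. c * (\<Prod>i\<in>UNIV. of_real (\<xi>$i) ^ e i) * G \<xi>) else (\<lambda>_. 0))"
proof
  fix \<xi> :: "real^6"
  let ?h = "\<lambda>i. (of_real (\<xi>$i) :: complex) ^ e i"
  have 1: "(\<Prod>i\<in>UNIV. (of_real (flip j \<xi> $ i) :: complex) ^ e i) = (-1) ^ e j * (\<Prod>i\<in>UNIV. ?h i)"
  proof -
    have "(\<Prod>i\<in>UNIV. (of_real (flip j \<xi> $ i) :: complex) ^ e i) =
        (- of_real (\<xi>$j)) ^ e j * (\<Prod>i\<in>UNIV - {j}. (of_real (flip j \<xi> $ i) :: complex) ^ e i)"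
      by (subst prod.remove[of _ j]) (auto simp: flip_def)
    also have "(\<Prod>i\<in>UNIV - {j}. (of_real (flip j \<xi> $ i) :: complex) ^ e i) = (\<Prod>i\<in>UNIV - {j}. ?h i)"
      by (intro prod.cong) (auto simp: flip_def)
    also have "(- of_real (\<xi>$j)) ^ e j = (-1) ^ e j * ?h j"
      by (metis power_minus)
    finally show ?thesis
      by (subst prod.remove[of UNIV j]) (auto simp: mult.assoc)
  qed
  show "even_in j (\<lambda>\<xi>. c * (\<Prod>i\<in>UNIV. of_real (\<xi>$i) ^ e i) * G \<xi>) \<xi> =
    (if even (e j) then (\<lambda>\<xi>. c * (\<Prod>i\<in>UNIV. of_real (\<xi>$i) ^ e i) * G \<xi>) else (\<lambda>_. 0)) \<xi>"
    by (simp add: even_in_def 1 assms)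
qed

lemma even_part_term:
  assumes "\<And>j \<xi>. G (flip j \<xi>) = G \<xi>"
  shows "even_part (\<lambda>\<xi>. c * (\<Prod>i\<in>UNIV. of_real (\<xi>$i) ^ e i) * G \<xi>) =
    (if \<forall>i\<in>{1, 2, 3, 4, 5, 6}. even (e i)
     then (\<lambda>\<xi>. c * (\<Prod>i\<in>UNIV. of_real (\<xi>$i) ^ e i) * G \<xi>) else (\<lambda>_. 0))"
proof -
  have z: "even_in j (\<lambda>_. 0) = (\<lambda>_. 0)" for j
    by (simp add: even_in_def fun_eq_iff)
  show ?thesis
    unfolding even_part_def
    by (auto simp: even_in_term[of G, OF assms] z)
qed

end

theory Submission
  imports Defs
begin

text \<open>
  No explicit formula for \<open>b\<^bsub>-6\<^esub>\<close> is needed. With \<open>q = (\<xi>\<^sub>1 - 3\<i>a'/2a) \<gamma>\<^sub>1 + (\<xi>\<^sub>2 - \<i>(cot \<eta> - tan \<eta>)/2) \<gamma>\<^sub>2/a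
  + u\<^sub>3 \<gamma>\<^sub>3/a + u\<^sub>4 \<gamma>\<^sub>4/a\<close>, where \<open>\<gamma>\<^sub>1, \<dots>, \<gamma>\<^sub>4\<close> are Clifford generators, every entry of every symbol is a
  polynomial over the rationals in \<open>\<i>\<close>, the \<open>u\<^sub>j\<close>, \<open>1/a\<close>, the derivatives of \<open>a\<close>, \<open>tan \<eta>\<close>, \<open>cot \<eta>\<close> and
  the inverse of the quadratic form, and two parities are preserved by the recursion for the parametrix.
  They belong to the symmetries that change the signs of \<open>\<i>, \<xi>\<^sub>1, \<xi>\<^sub>2, \<gamma>\<^sub>1, \<gamma>\<^sub>2\<close>, respectively of
  \<open>\<xi>\<^sub>2, u\<^sub>3, tan \<eta>, cot \<eta>, \<gamma>\<^sub>2, \<gamma>\<^sub>3\<close>. In a monomial of the trace that is even in each \<open>\<xi>\<^sub>j\<close> the exponent of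
  \<open>\<i>\<close> and the total exponent of \<open>tan \<eta>\<close> and \<open>cot \<eta>\<close> are therefore even, so the monomial is a rational
  function of \<open>u\<^sub>0 = sin\<^sup>2 \<eta>\<close> with rational coefficients. The order of differentiation of \<open>a\<close> is bounded
  by \<open>N\<close> in \<open>\<sigma>\<^bsub>-2-N\<^esub>\<close>. The Jacobian of the change of variables cancels because
  \<open>du\<^sub>0 = 2 sin \<eta> cos \<eta> d\<eta>\<close> and the multiples of \<open>d\<eta>\<close> in \<open>du\<^sub>3, du\<^sub>4\<close> are killed by the wedge with \<open>d\<eta>\<close>.
\<close>

section \<open>Polynomial functions over the rationals\<close>

definition mono_eval :: "('v \<Rightarrow> complex) \<Rightarrow> ('v \<Rightarrow>\<^sub>0 nat) \<Rightarrow> complex" where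
  "mono_eval z m = (\<Prod>i\<in>Poly_Mapping.keys m. z i ^ Poly_Mapping.lookup m i)"

text \<open>Indices outside the support contribute a zeroth power, which is 1, so monomials with
  different supports can be compared over one index set.\<close>

lemma mono_eval_superset:
  assumes "finite A" "Poly_Mapping.keys m \<subseteq> A"
  shows "mono_eval z m = (\<Prod>i\<in>A. z i ^ Poly_Mapping.lookup m i)"
  unfolding mono_eval_def using assms
  by (intro prod.mono_neutral_left) (auto simp: in_keys_iff)

lemma mono_eval_add: "mono_eval z (m + n) = mono_eval z m * mono_eval z n"
proof -
  let ?A = "Poly_Mapping.keys m \<union> Poly_Mapping.keys n"
  have "Poly_Mapping.keys (m + n) \<subseteq> ?A" by (rule Poly_Mapping.keys_add)
  then show ?thesis
    by (simp add: mono_eval_superset[of ?A] lookup_add power_add prod.distrib)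
qed

lemma qeval_superset:
  assumes "finite A" "Poly_Mapping.keys P \<subseteq> A"
  shows "qeval z P = (\<Sum>m\<in>A. of_rat (Poly_Mapping.lookup P m) * mono_eval z m)"
  unfolding qeval_def mono_eval_def using assms
  by (intro sum.mono_neutral_left) (auto simp: in_keys_iff)

lemma qeval_add: "qeval z (P + R) = qeval z P + qeval z R"
proof -
  let ?A = "Poly_Mapping.keys P \<union> Poly_Mapping.keys R"
  have "Poly_Mapping.keys (P + R) \<subseteq> ?A" by (rule Poly_Mapping.keys_add)
  then show ?thesis
    by (simp add: qeval_superset[of ?A] lookup_add of_rat_add sum.distrib distrib_right)
qed

lemma qeval_0 [simp]: "qeval z 0 = 0"
  by (simp add: qeval_def)

lemma qeval_single: "qeval z (Poly_Mapping.single m c) = of_rat c * mono_eval z m"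
  by (subst qeval_superset[of "{m}"]) auto

text \<open>Every polynomial is a sum of monomials: \<open>update_induct\<close> inserts keys that
  are still absent, and such an insertion is an addition.\<close>

lemma qeval_induct [case_names zero single add]:
  assumes "Pr 0" "\<And>m c. Pr (Poly_Mapping.single m c)" "\<And>P R. Pr P \<Longrightarrow> Pr R \<Longrightarrow> Pr (P + R)"
  shows "Pr (P :: 'v qpoly)"
proof (induction P rule: update_induct)
  case const
  show ?case by (simp add: assms(1))
next
  case (update P m c)
  have "Poly_Mapping.update m c P = P + Poly_Mapping.single m c"
    using update.hyps by (intro poly_mapping_eqI) (auto simp: lookup_update lookup_add lookup_single in_keys_iff when_def)
  then show ?case using update assms by simp
qed

lemma qeval_mult: "qeval z (P * R) = qeval z P * qeval z R"
proof (induction P rule: qeval_induct)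
  case (single m c)
  show ?case
    by (induction R rule: qeval_induct)
       (simp_all add: distrib_left qeval_add mult_single qeval_single of_rat_mult mono_eval_add)
qed (simp_all add: distrib_right qeval_add)

text \<open>A property of functions rather than of elements of \<open>qpoly\<close>, so that
  introduction rules can verify it along the shape of an expression.\<close>

definition polynomial_over_Q :: "(('v \<Rightarrow> complex) \<Rightarrow> complex) \<Rightarrow> bool" where
  "polynomial_over_Q g \<longleftrightarrow> (\<exists>P. \<forall>z. g z = qeval z P)"

lemma polynomial_over_Q_of_rat: "polynomial_over_Q (\<lambda>z. of_rat c)"
  unfolding polynomial_over_Q_def
  by (rule exI[of _ "Poly_Mapping.single 0 c"]) (simp add: qeval_single mono_eval_def)

lemma polynomial_over_Q_var: "polynomial_over_Q (\<lambda>z. z i)"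
  unfolding polynomial_over_Q_def
  by (rule exI[of _ "Poly_Mapping.single (Poly_Mapping.single i 1) 1"])
     (simp add: qeval_single mono_eval_def)

lemma polynomial_over_Q_add:
  "polynomial_over_Q g \<Longrightarrow> polynomial_over_Q h \<Longrightarrow> polynomial_over_Q (\<lambda>z. g z + h z)"
  unfolding polynomial_over_Q_def by (metis qeval_add)

lemma polynomial_over_Q_mult:
  "polynomial_over_Q g \<Longrightarrow> polynomial_over_Q h \<Longrightarrow> polynomial_over_Q (\<lambda>z. g z * h z)"
  unfolding polynomial_over_Q_def by (metis qeval_mult)

lemma polynomial_over_Q_consts:
  "polynomial_over_Q (\<lambda>z. 0)" "polynomial_over_Q (\<lambda>z. 1)" "polynomial_over_Q (\<lambda>z. numeral w)"
  using polynomial_over_Q_of_rat[of 0] polynomial_over_Q_of_rat[of 1]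
    polynomial_over_Q_of_rat[of "numeral w"] by simp_all

lemma polynomial_over_Q_uminus:
  "polynomial_over_Q g \<Longrightarrow> polynomial_over_Q (\<lambda>z. - g z)"
  using polynomial_over_Q_mult[OF polynomial_over_Q_of_rat[of "-1"], of g]
  by (simp add: of_rat_minus)

lemma polynomial_over_Q_diff:
  "polynomial_over_Q g \<Longrightarrow> polynomial_over_Q h \<Longrightarrow> polynomial_over_Q (\<lambda>z. g z - h z)"
  using polynomial_over_Q_add[OF _ polynomial_over_Q_uminus[of h], of g] by simp

lemma polynomial_over_Q_power:
  "polynomial_over_Q g \<Longrightarrow> polynomial_over_Q (\<lambda>z. g z ^ n)"
  by (induction n) (auto intro: polynomial_over_Q_mult polynomial_over_Q_consts)

lemma polynomial_over_Q_sum: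
  "(\<And>i. i \<in> A \<Longrightarrow> polynomial_over_Q (g i)) \<Longrightarrow> polynomial_over_Q (\<lambda>z. \<Sum>i\<in>A. g i z)"
  by (induction A rule: infinite_finite_induct)
     (auto intro: polynomial_over_Q_add polynomial_over_Q_consts)

lemma polynomial_over_Q_prod:
  "(\<And>i. i \<in> A \<Longrightarrow> polynomial_over_Q (g i)) \<Longrightarrow> polynomial_over_Q (\<lambda>z. \<Prod>i\<in>A. g i z)"
  by (induction A rule: infinite_finite_induct)
     (auto intro: polynomial_over_Q_mult polynomial_over_Q_consts)

lemmas polynomial_over_Q_intros =
  polynomial_over_Q_of_rat polynomial_over_Q_var polynomial_over_Q_add polynomial_over_Q_mult
  polynomial_over_Q_consts polynomial_over_Q_uminus polynomial_over_Q_diff polynomial_over_Q_power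
  polynomial_over_Q_sum polynomial_over_Q_prod

text \<open>Serves to specialise some variables to rational constants, as on a slice with fixed
  \<alpha>.\<close>

lemma polynomial_over_Q_subst:
  assumes "\<And>i. polynomial_over_Q (\<lambda>z. h z i)"
  shows "polynomial_over_Q (\<lambda>z. qeval (h z) P)"
  unfolding qeval_def by (intro polynomial_over_Q_intros assms)

section \<open>Wedge products\<close>

text \<open>Each term of the determinant contains exactly one factor from the slot after
  \<open>xs\<close>.\<close>

lemma wedge_linear:
  "wedge (xs @ (\<lambda>w. c * \<theta> w + d * \<omega> w) # ys) v =
     c * wedge (xs @ \<theta> # ys) v + d * wedge (xs @ \<omega> # ys) v"
proof -
  define n where "n = length xs + Suc (length ys)"
  \<comment> \<open>The remaining factors do not see \<open>\<kappa>\<close>; writing them with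
    \<open>\<theta>\<close> gives all three wedges the same cofactors.\<close>
  have split: "(\<Prod>i<n. ((xs @ \<kappa> # ys) ! i) (v (\<pi> i))) =
      \<kappa> (v (\<pi> (length xs))) * (\<Prod>i\<in>{..<n} - {length xs}. ((xs @ \<theta> # ys) ! i) (v (\<pi> i)))"
    for \<kappa> \<pi>
  proof -
    have "(\<Prod>i<n. ((xs @ \<kappa> # ys) ! i) (v (\<pi> i))) = ((xs @ \<kappa> # ys) ! length xs) (v (\<pi> (length xs))) *
        (\<Prod>i\<in>{..<n} - {length xs}. ((xs @ \<kappa> # ys) ! i) (v (\<pi> i)))"
      by (rule prod.remove) (auto simp: n_def)
    also have "(\<Prod>i\<in>{..<n} - {length xs}. ((xs @ \<kappa> # ys) ! i) (v (\<pi> i))) =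
        (\<Prod>i\<in>{..<n} - {length xs}. ((xs @ \<theta> # ys) ! i) (v (\<pi> i)))"
      by (intro prod.cong refl) (auto simp: nth_append nth_Cons')
    finally show ?thesis by simp
  qed
  have len: "length (xs @ \<kappa> # ys) = n" for \<kappa>
    by (simp add: n_def)
  show ?thesis
    unfolding wedge_def len split
    by (simp add: sum_distrib_left sum.distrib algebra_simps)
qed

text \<open>Composing with the transposition of \<open>i\<close> and \<open>j\<close> permutes the
  terms of the sum and changes their signs, so the wedge is its own negative.\<close>

lemma wedge_repeated:
  assumes "i < j" "j < length \<theta>s" "\<theta>s ! i = \<theta>s ! j"
  shows "wedge \<theta>s v = 0"
proof -
  let ?n = "length \<theta>s" and ?\<tau> = "Transposition.transpose i j"
  let ?f = "\<lambda>\<pi>. of_int (sign \<pi>) * (\<Prod>k<?n. (\<theta>s ! k) (v (\<pi> k)))"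
  have \<tau>: "?\<tau> permutes {..<?n}"
    using assms by (intro permutes_swap_id) auto
  have sgn: "sign (\<pi> \<circ> ?\<tau>) = - sign \<pi>" if "\<pi> permutes {..<?n}" for \<pi>
    using that \<tau> assms(1)
    by (subst sign_compose) (auto intro: permutation_permutes[THEN iffD2] simp: sign_swap_id)
  have "?f (\<pi> \<circ> ?\<tau>) = - ?f \<pi>" if "\<pi> permutes {..<?n}" for \<pi>
  proof -
    have "(\<Prod>k<?n. (\<theta>s ! k) (v ((\<pi> \<circ> ?\<tau>) k))) = (\<Prod>k<?n. (\<theta>s ! ?\<tau> k) (v (\<pi> (?\<tau> k))))"
      by (intro prod.cong refl) (auto simp: Transposition.transpose_def assms)
    also have "\<dots> = (\<Prod>k<?n. (\<theta>s ! k) (v (\<pi> k)))"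
      by (rule prod.permute[OF \<tau>, unfolded comp_def, symmetric])
    finally show ?thesis using sgn[OF that] by simp
  qed
  then have "wedge \<theta>s v = - wedge \<theta>s v"
    unfolding wedge_def
    by (subst sum_permutations_compose_right[OF \<tau>]) (simp add: sum_negf)
  then show ?thesis by simp
qed


text \<open>Row reduction from left to right: \<open>is\<close> lists the slots already cleared of
  \<open>\<theta>\<close>, and the multiple of \<open>\<theta>\<close> in the next slot vanishes
  because it repeats the first factor.\<close>

lemma wedge_reduce:
  "wedge (\<theta> # map \<phi> is @ map (\<lambda>i w. r i * \<phi> i w + t i * \<theta> w) js) v =
     (\<Prod>i\<leftarrow>js. r i) * wedge (\<theta> # map \<phi> (is @ js)) v"
proof (induction js arbitrary: "is")
  case (Cons j js)
  have "wedge ((\<theta> # map \<phi> is) @ (\<lambda>w. r j * \<phi> j w + t j * \<theta> w) # map (\<lambda>i w. r i * \<phi> i w + t i * \<theta> w) js) v =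
      r j * wedge ((\<theta> # map \<phi> is) @ \<phi> j # map (\<lambda>i w. r i * \<phi> i w + t i * \<theta> w) js) v
      + t j * wedge ((\<theta> # map \<phi> is) @ \<theta> # map (\<lambda>i w. r i * \<phi> i w + t i * \<theta> w) js) v"
    by (rule wedge_linear)
  also have "wedge ((\<theta> # map \<phi> is) @ \<theta> # map (\<lambda>i w. r i * \<phi> i w + t i * \<theta> w) js) v = 0"
    by (rule wedge_repeated[of 0 "Suc (length is)"]) (auto simp: nth_append)
  also have "wedge ((\<theta> # map \<phi> is) @ \<phi> j # map (\<lambda>i w. r i * \<phi> i w + t i * \<theta> w) js) v =
      (\<Prod>i\<leftarrow>js. r i) * wedge (\<theta> # map \<phi> ((is @ [j]) @ js)) v"
    using Cons.IH[of "is @ [j]"] by simp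
  finally show ?case by simp
qed simp

text \<open>Intended for the change of variables, with \<open>\<theta>\<close> the differential of
  \<eta>, \<open>\<phi> i\<close> that of \<xi>_i, and the entries of the left-hand wedge the
  pullbacks of du_0 and du_i.\<close>

lemma wedge_triangular:
  "wedge ((\<lambda>w. c * \<theta> w) # map (\<lambda>i w. r i * \<phi> i w + t i * \<theta> w) js) v =
     c * (\<Prod>i\<leftarrow>js. r i) * wedge (\<theta> # map \<phi> js) v"
  using wedge_linear[of "[]" c \<theta> 0 "\<lambda>_. 0"] wedge_reduce[of \<theta> \<phi> "[]" r t js v]
  by simp

section \<open>Graded families of functions\<close>

type_synonym family = "(real \<Rightarrow> real) \<Rightarrow> real^4 \<Rightarrow> real^6 \<Rightarrow> complex"

text \<open>The common domain of all identities between families; here a, sin \<eta>, cos \<eta> and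
  the quadratic form are positive.\<close>

definition regular_point :: "(real \<Rightarrow> real) \<Rightarrow> real^4 \<Rightarrow> real^6 \<Rightarrow> bool" where
  "regular_point a x \<xi> \<longleftrightarrow> (\<exists>T. smooth_on_open T a \<and> (\<forall>t\<in>T. a t > 0) \<and> x$1 \<in> T) \<and>
     0 < x$2 \<and> x$2 < pi / 2 \<and> \<xi> \<noteq> 0"

lemma regular_point_facts:
  assumes "regular_point a x \<xi>"
  shows "a (x$1) > 0" "sin (x$2) > 0" "cos (x$2) > 0"
    "((deriv ^^ i) a has_real_derivative (deriv ^^ Suc i) a (x$1)) (at (x$1))"
  using assms
  by (auto simp: regular_point_def smooth_on_open_def cos_gt_zero sin_gt_zero
      DERIV_deriv_iff_real_differentiable)

text \<open>Regularity is an open condition along lines, so families that agree at regular points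
  have the same directional derivatives there.\<close>

lemma eventually_regular_point:
  assumes "regular_point a x \<xi>"
  shows "\<forall>\<^sub>F s in at 0. regular_point a (x + s *\<^sub>R vx) (\<xi> + s *\<^sub>R v\<xi>)"
proof -
  obtain T where T: "smooth_on_open T a" "\<forall>t\<in>T. a t > 0" "x$1 \<in> T"
    using assms by (auto simp: regular_point_def)
  have x: "((\<lambda>s. (x + s *\<^sub>R vx) $ i) \<longlongrightarrow> x $ i) (at 0)" for i
    by (auto intro!: tendsto_eq_intros)
  have \<xi>: "((\<lambda>s. \<xi> + s *\<^sub>R v\<xi>) \<longlongrightarrow> \<xi>) (at 0)"
    by (auto intro!: tendsto_eq_intros)
  have "\<forall>\<^sub>F s in at 0. (x + s *\<^sub>R vx) $ 1 \<in> T"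
    using T by (intro topological_tendstoD[OF x]) (auto simp: smooth_on_open_def)
  moreover have "\<forall>\<^sub>F s in at 0. 0 < (x + s *\<^sub>R vx) $ 2"
    using assms by (intro order_tendstoD(1)[OF x]) (auto simp: regular_point_def)
  moreover have "\<forall>\<^sub>F s in at 0. (x + s *\<^sub>R vx) $ 2 < pi / 2"
    using assms by (intro order_tendstoD(2)[OF x]) (auto simp: regular_point_def)
  moreover have "\<forall>\<^sub>F s in at 0. \<xi> + s *\<^sub>R v\<xi> \<noteq> 0"
    using assms by (intro tendsto_imp_eventually_ne[OF \<xi>]) (auto simp: regular_point_def)
  ultimately show ?thesis
    by eventually_elim (use T in \<open>auto simp: regular_point_def\<close>)
qed

text \<open>The scalar principal symbol of \<Delta>_4, which becomes \<open>Q4\<close> in the new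
  variables.\<close>

definition quad :: "(real \<Rightarrow> real) \<Rightarrow> real^4 \<Rightarrow> real^6 \<Rightarrow> real" where
  "quad a x \<xi> = (\<xi>$1)\<^sup>2 + ((\<xi>$2)\<^sup>2 + (\<xi>$3 / sin (x$2))\<^sup>2 + (\<xi>$4 / cos (x$2))\<^sup>2) / (a (x$1))\<^sup>2
     + (\<xi>$5)\<^sup>2 + (\<xi>$6)\<^sup>2"

lemma UNIV_6: "(UNIV :: 6 set) = {1, 2, 3, 4, 5, 6}"
proof -
  have "x \<in> {1, 2, 3, 4, 5, 6}" for x :: 6
  proof (cases x rule: bit0_cases)
    case (of_int z)
    \<comment> \<open>In the type \<open>6\<close> the representative 0 is the index 6.\<close>
    then have "z \<in> {0, 1, 2, 3, 4, 5}" by auto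
    then show ?thesis using of_int by auto
  qed
  then show ?thesis by blast
qed

lemma forall_6: "(\<forall>i::6. P i) \<longleftrightarrow> P 1 \<and> P 2 \<and> P 3 \<and> P 4 \<and> P 5 \<and> P 6"
  using UNIV_6 by (metis (full_types) UNIV_I empty_iff insertE)

lemma quad_pos:
  assumes "regular_point a x \<xi>"
  shows "quad a x \<xi> > 0"
proof -
  note f = regular_point_facts[OF assms]
  have nz: "\<xi> \<noteq> 0" using assms by (simp add: regular_point_def)
  have ge: "quad a x \<xi> \<ge> 0" by (simp add: quad_def)
  have "quad a x \<xi> \<noteq> 0"
  proof
    assume "quad a x \<xi> = 0"
    then have "\<xi> = 0"
      using f(1-3) unfolding quad_def
      by (auto simp: vec_eq_iff forall_6 add_nonneg_eq_0_iff)
    with nz show False by simp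
  qed
  with ge show ?thesis by simp
qed

text \<open>The first parity is that of the degree in \<open>\<i>, \<xi>\<^sub>1, \<xi>\<^sub>2\<close>, the second one that of the degree in
  \<open>\<xi>\<^sub>2, csc \<eta> \<xi>\<^sub>3, tan \<eta>, cot \<eta>\<close>; the number bounds the order of the derivatives of \<open>a\<close>.\<close>

inductive graded :: "nat \<Rightarrow> bool \<Rightarrow> bool \<Rightarrow> family \<Rightarrow> bool" for n where
  rat: "graded n False False (\<lambda>a x \<xi>. of_rat c)"
| imag: "graded n True False (\<lambda>a x \<xi>. \<i>)"
| u1: "graded n True False (\<lambda>a x \<xi>. of_real (\<xi>$1))"
| u2: "graded n True True (\<lambda>a x \<xi>. of_real (\<xi>$2))"
| u3: "graded n False True (\<lambda>a x \<xi>. of_real (\<xi>$3 / sin (x$2)))"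
| u4: "graded n False False (\<lambda>a x \<xi>. of_real (\<xi>$4 / cos (x$2)))"
| u5: "graded n False False (\<lambda>a x \<xi>. of_real (\<xi>$5))"
| u6: "graded n False False (\<lambda>a x \<xi>. of_real (\<xi>$6))"
| alpha: "i \<le> n \<Longrightarrow> graded n False False (\<lambda>a x \<xi>. of_real ((deriv ^^ i) a (x$1)))"
| inv_alpha: "graded n False False (\<lambda>a x \<xi>. of_real (1 / a (x$1)))"
| tan: "graded n False True (\<lambda>a x \<xi>. of_real (tan (x$2)))"
| cot: "graded n False True (\<lambda>a x \<xi>. of_real (cot (x$2)))"
| inv_quad: "graded n False False (\<lambda>a x \<xi>. of_real (1 / quad a x \<xi>))"
| add: "graded n \<epsilon> \<delta> g \<Longrightarrow> graded n \<epsilon> \<delta> h \<Longrightarrow> graded n \<epsilon> \<delta> (\<lambda>a x \<xi>. g a x \<xi> + h a x \<xi>)"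
| mult: "graded n \<epsilon> \<delta> g \<Longrightarrow> graded n \<epsilon>' \<delta>' h \<Longrightarrow> \<epsilon>'' = (\<epsilon> \<noteq> \<epsilon>') \<Longrightarrow> \<delta>'' = (\<delta> \<noteq> \<delta>') \<Longrightarrow>
    graded n \<epsilon>'' \<delta>'' (\<lambda>a x \<xi>. g a x \<xi> * h a x \<xi>)"
| cong: "graded n \<epsilon> \<delta> g \<Longrightarrow> (\<And>a x \<xi>. regular_point a x \<xi> \<Longrightarrow> h a x \<xi> = g a x \<xi>) \<Longrightarrow> graded n \<epsilon> \<delta> h"

section \<open>Closure properties of graded families\<close>

lemma graded_mono: "graded m \<epsilon> \<delta> g \<Longrightarrow> m \<le> n \<Longrightarrow> graded n \<epsilon> \<delta> g"
proof (induction rule: graded.induct)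
  case (cong \<epsilon> \<delta> g h)
  then show ?case by (blast intro: graded.cong)
next
  case (mult \<epsilon> \<delta> g \<epsilon>' \<delta>' h)
  then show ?case by (blast intro: graded.mult)
qed (auto simp del: of_real_divide intro: graded.intros(1-14))

text \<open>Zero has every parity, being 0 times a generator of each of the four parities. Empty
  sums and vanishing matrix entries rely on this.\<close>

lemma graded_0: "graded n \<epsilon> \<delta> (\<lambda>a x \<xi>. 0)"
proof -
  have z: "graded n False False (\<lambda>a x \<xi>. of_rat 0)" by (rule graded.rat)
  have "graded n e d (\<lambda>a x \<xi>. 0)" if "graded n e d g" for e d g
    by (rule graded.cong[OF graded.mult[OF z that]]) auto
  note this[OF graded.imag] this[OF graded.rat] this[OF graded.u2] this[OF graded.u3]
  then show ?thesis by (cases \<epsilon>; cases \<delta>) auto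
qed

lemma graded_1: "graded n False False (\<lambda>a x \<xi>. 1)"
  using graded.rat[of n 1] by simp

lemma graded_numeral: "graded n False False (\<lambda>a x \<xi>. numeral w)"
  using graded.rat[of n "numeral w"] by simp

lemma graded_uminus: "graded n \<epsilon> \<delta> g \<Longrightarrow> graded n \<epsilon> \<delta> (\<lambda>a x \<xi>. - g a x \<xi>)"
  using graded.mult[OF graded.rat[of n "-1"], of \<epsilon> \<delta> g] by (simp add: of_rat_minus)

lemma graded_diff:
  "graded n \<epsilon> \<delta> g \<Longrightarrow> graded n \<epsilon> \<delta> h \<Longrightarrow> graded n \<epsilon> \<delta> (\<lambda>a x \<xi>. g a x \<xi> - h a x \<xi>)"
  using graded.add[OF _ graded_uminus] by fastforce

lemma graded_sum:
  "(\<And>i. i \<in> A \<Longrightarrow> graded n \<epsilon> \<delta> (g i)) \<Longrightarrow> graded n \<epsilon> \<delta> (\<lambda>a x \<xi>. \<Sum>i\<in>A. g i a x \<xi>)"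
  by (induction A rule: infinite_finite_induct) (auto intro: graded.add graded_0)

lemma graded_power:
  "graded n \<epsilon> \<delta> g \<Longrightarrow> graded n (\<epsilon> \<and> odd k) (\<delta> \<and> odd k) (\<lambda>a x \<xi>. g a x \<xi> ^ k)"
  by (induction k) (auto intro: graded_1 graded.mult)

text \<open>The parity of a square is constant, which spares resolution a unification with
  \<open>\<epsilon> \<and> odd k\<close>.\<close>

lemma graded_square:
  "graded n \<epsilon> \<delta> g \<Longrightarrow> graded n False False (\<lambda>a x \<xi>. (g a x \<xi>)\<^sup>2)"
  using graded_power[of n \<epsilon> \<delta> g 2] by simp

text \<open>As a relation, exclusive or lets resolution compute the parity of a product.\<close>

definition xor_rel :: "bool \<Rightarrow> bool \<Rightarrow> bool \<Rightarrow> bool" where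
  "xor_rel p q r \<longleftrightarrow> r = (p \<noteq> q)"

lemma xor_rel_table: "xor_rel False False False" "xor_rel False True True"
  "xor_rel True False True" "xor_rel True True False"
  by (simp_all add: xor_rel_def)

lemma graded_mult:
  "graded n \<epsilon> \<delta> g \<Longrightarrow> graded n \<epsilon>' \<delta>' h \<Longrightarrow> xor_rel \<epsilon> \<epsilon>' \<epsilon>'' \<Longrightarrow> xor_rel \<delta> \<delta>' \<delta>'' \<Longrightarrow>
    graded n \<epsilon>'' \<delta>'' (\<lambda>a x \<xi>. g a x \<xi> * h a x \<xi>)"
  by (auto simp: xor_rel_def intro: graded.mult)

lemma graded_alpha_0: "graded n False False (\<lambda>a x \<xi>. of_real (a (x$1)))"
  using graded.alpha[of 0 n] by simp

lemma graded_alpha_1: "graded (Suc n) False False (\<lambda>a x \<xi>. of_real (deriv a (x$1)))"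
  using graded.alpha[of 1 "Suc n"] by simp

lemmas graded_intros = graded_0 graded_1 graded_numeral graded.intros(1-8,10-14) graded_alpha_0
  graded_alpha_1 graded_uminus graded_diff graded_square graded_mult xor_rel_table

text \<open>\<open>\<partial>/\<partial>\<xi>\<^sub>3\<close> and \<open>\<partial>/\<partial>\<xi>\<^sub>4\<close> would introduce the factors \<open>csc \<eta>\<close> and \<open>sec \<eta>\<close>. They only occur together with
  derivatives in \<open>\<phi>\<^sub>1, \<phi>\<^sub>2\<close>, on which nothing depends.\<close>

definition has_derivs :: "family \<Rightarrow> family \<Rightarrow> family \<Rightarrow> family \<Rightarrow> family \<Rightarrow> bool" where
  "has_derivs g gt ge g1 g2 \<longleftrightarrow> (\<forall>a x \<xi> vx v\<xi>. regular_point a x \<xi> \<longrightarrow>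
       v\<xi>$3 = 0 \<longrightarrow> v\<xi>$4 = 0 \<longrightarrow> v\<xi>$5 = 0 \<longrightarrow> v\<xi>$6 = 0 \<longrightarrow>
       ((\<lambda>s. g a (x + s *\<^sub>R vx) (\<xi> + s *\<^sub>R v\<xi>)) has_vector_derivative
         of_real (vx$1) * gt a x \<xi> + of_real (vx$2) * ge a x \<xi>
         + of_real (v\<xi>$1) * g1 a x \<xi> + of_real (v\<xi>$2) * g2 a x \<xi>) (at 0))"

text \<open>Each derivative shifts the parities by those of its coordinate: t is even for both,
  \<eta> is odd for the second like tan \<eta>, \<xi>_1 is odd for the first, \<xi>_2 for
  both.\<close>

definition has_graded_derivs :: "nat \<Rightarrow> bool \<Rightarrow> bool \<Rightarrow> family \<Rightarrow> bool" where
  "has_graded_derivs n \<epsilon> \<delta> g \<longleftrightarrow> (\<exists>gt ge g1 g2.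
     graded n \<epsilon> \<delta> gt \<and> graded n \<epsilon> (\<not> \<delta>) ge \<and> graded n (\<not> \<epsilon>) \<delta> g1 \<and> graded n (\<not> \<epsilon>) (\<not> \<delta>) g2 \<and>
     has_derivs g gt ge g1 g2)"

lemma has_graded_derivsI:
  assumes "graded n \<epsilon> \<delta> gt" "graded n \<epsilon> (\<not> \<delta>) ge" "graded n (\<not> \<epsilon>) \<delta> g1" "graded n (\<not> \<epsilon>) (\<not> \<delta>) g2"
    and "has_derivs g gt ge g1 g2"
  shows "has_graded_derivs n \<epsilon> \<delta> g"
  unfolding has_graded_derivs_def using assms by blast

lemma has_graded_derivsE:
  assumes "has_graded_derivs n \<epsilon> \<delta> g"
  obtains gt ge g1 g2 where "graded n \<epsilon> \<delta> gt" "graded n \<epsilon> (\<not> \<delta>) ge" "graded n (\<not> \<epsilon>) \<delta> g1"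
    "graded n (\<not> \<epsilon>) (\<not> \<delta>) g2" "has_derivs g gt ge g1 g2"
  using assms unfolding has_graded_derivs_def by blast

section \<open>Differentiation rules for sums, products and agreeing families\<close>

lemma has_derivs_add:
  assumes "has_derivs g gt ge g1 g2" "has_derivs h ht he h1 h2"
  shows "has_derivs (\<lambda>a x \<xi>. g a x \<xi> + h a x \<xi>) (\<lambda>a x \<xi>. gt a x \<xi> + ht a x \<xi>)
    (\<lambda>a x \<xi>. ge a x \<xi> + he a x \<xi>) (\<lambda>a x \<xi>. g1 a x \<xi> + h1 a x \<xi>) (\<lambda>a x \<xi>. g2 a x \<xi> + h2 a x \<xi>)"
  unfolding has_derivs_def
proof (intro allI impI, goal_cases)
  case (1 a x \<xi> vx v\<xi>)
  from has_vector_derivative_add[OF assms[unfolded has_derivs_def, rule_format, OF 1, of vx]]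
  show ?case by (rule has_vector_derivative_eq_rhs) (simp add: algebra_simps)
qed

lemma has_derivs_mult:
  assumes "has_derivs g gt ge g1 g2" "has_derivs h ht he h1 h2"
  shows "has_derivs (\<lambda>a x \<xi>. g a x \<xi> * h a x \<xi>) (\<lambda>a x \<xi>. g a x \<xi> * ht a x \<xi> + gt a x \<xi> * h a x \<xi>)
    (\<lambda>a x \<xi>. g a x \<xi> * he a x \<xi> + ge a x \<xi> * h a x \<xi>) (\<lambda>a x \<xi>. g a x \<xi> * h1 a x \<xi> + g1 a x \<xi> * h a x \<xi>)
    (\<lambda>a x \<xi>. g a x \<xi> * h2 a x \<xi> + g2 a x \<xi> * h a x \<xi>)"
  unfolding has_derivs_def
proof (intro allI impI, goal_cases)
  case (1 a x \<xi> vx v\<xi>)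
  from has_vector_derivative_mult[OF assms[unfolded has_derivs_def, rule_format, OF 1, of vx]]
  show ?case by (rule has_vector_derivative_eq_rhs) (simp add: algebra_simps)
qed

lemma has_derivs_cong:
  assumes "has_derivs g gt ge g1 g2" "\<And>a x \<xi>. regular_point a x \<xi> \<Longrightarrow> h a x \<xi> = g a x \<xi>"
  shows "has_derivs h gt ge g1 g2"
  unfolding has_derivs_def
proof (intro allI impI, goal_cases)
  case (1 a x \<xi> vx v\<xi>)
  from assms(1)[unfolded has_derivs_def, rule_format, OF 1, of vx]
  show ?case
    unfolding has_vector_derivative_def
    by (rule has_derivative_transform_eventually)
       (rule eventually_mono[OF eventually_regular_point[OF 1(1), of vx v\<xi>]], simp_all add: assms(2) 1(1))
qed

lemma has_graded_derivs_of_real: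
  assumes "graded n \<epsilon> \<delta> (\<lambda>a x \<xi>. of_real (gt a x \<xi>))" "graded n \<epsilon> (\<not> \<delta>) (\<lambda>a x \<xi>. of_real (ge a x \<xi>))"
    "graded n (\<not> \<epsilon>) \<delta> (\<lambda>a x \<xi>. of_real (g1 a x \<xi>))" "graded n (\<not> \<epsilon>) (\<not> \<delta>) (\<lambda>a x \<xi>. of_real (g2 a x \<xi>))"
    and "\<And>a x \<xi> vx v\<xi>. regular_point a x \<xi> \<Longrightarrow> v\<xi>$3 = 0 \<Longrightarrow> v\<xi>$4 = 0 \<Longrightarrow> v\<xi>$5 = 0 \<Longrightarrow> v\<xi>$6 = 0 \<Longrightarrow>
       ((\<lambda>s. g a (x + s *\<^sub>R vx) (\<xi> + s *\<^sub>R v\<xi>)) has_real_derivative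
         vx$1 * gt a x \<xi> + vx$2 * ge a x \<xi> + v\<xi>$1 * g1 a x \<xi> + v\<xi>$2 * g2 a x \<xi>) (at 0)"
  shows "has_graded_derivs n \<epsilon> \<delta> (\<lambda>a x \<xi>. of_real (g a x \<xi>))"
  by (rule has_graded_derivsI[OF assms(1-4)])
     (use has_vector_derivative_of_real[OF assms(5), where 'a=complex] in \<open>simp add: has_derivs_def\<close>)

section \<open>Derivatives of the generators\<close>

lemma has_graded_derivs_generators:
  "has_graded_derivs n False False (\<lambda>a x \<xi>. of_rat c)"
  "has_graded_derivs n True False (\<lambda>a x \<xi>. \<i>)"
  "has_graded_derivs n True False (\<lambda>a x \<xi>. of_real (\<xi>$1))"
  "has_graded_derivs n True True (\<lambda>a x \<xi>. of_real (\<xi>$2))"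
  "has_graded_derivs n False False (\<lambda>a x \<xi>. of_real (\<xi>$5))"
  "has_graded_derivs n False False (\<lambda>a x \<xi>. of_real (\<xi>$6))"
proof -
  show "has_graded_derivs n False False (\<lambda>a x \<xi>. of_rat c)" "has_graded_derivs n True False (\<lambda>a x \<xi>. \<i>)"
    by (rule has_graded_derivsI[where gt="\<lambda>a x \<xi>. 0" and ge="\<lambda>a x \<xi>. 0" and ?g1.0="\<lambda>a x \<xi>. 0"
          and ?g2.0="\<lambda>a x \<xi>. 0"]; simp add: graded_0 has_derivs_def)+
  show "has_graded_derivs n False False (\<lambda>a x \<xi>. of_real (\<xi>$5))"
       "has_graded_derivs n False False (\<lambda>a x \<xi>. of_real (\<xi>$6))"
    by (rule has_graded_derivs_of_real[where gt="\<lambda>a x \<xi>. 0" and ge="\<lambda>a x \<xi>. 0" and ?g1.0="\<lambda>a x \<xi>. 0"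
          and ?g2.0="\<lambda>a x \<xi>. 0"]; simp add: graded_0)+
  show "has_graded_derivs n True False (\<lambda>a x \<xi>. of_real (\<xi>$1))"
    by (rule has_graded_derivs_of_real[where gt="\<lambda>a x \<xi>. 0" and ge="\<lambda>a x \<xi>. 0" and ?g1.0="\<lambda>a x \<xi>. 1"
          and ?g2.0="\<lambda>a x \<xi>. 0"])
       (auto simp: graded_0 graded_1 intro!: derivative_eq_intros)
  show "has_graded_derivs n True True (\<lambda>a x \<xi>. of_real (\<xi>$2))"
    by (rule has_graded_derivs_of_real[where gt="\<lambda>a x \<xi>. 0" and ge="\<lambda>a x \<xi>. 0" and ?g1.0="\<lambda>a x \<xi>. 0"
          and ?g2.0="\<lambda>a x \<xi>. 1"])
       (auto simp: graded_0 graded_1 intro!: derivative_eq_intros)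
qed

lemma DERIV_along_line:
  fixes x :: "real^'n"
  assumes "(f has_real_derivative D) (at (x$i))"
  shows "((\<lambda>s. f ((x + s *\<^sub>R v)$i)) has_real_derivative v$i * D) (at 0)"
proof -
  have "((\<lambda>s. (x + s *\<^sub>R v) $ i) has_real_derivative v $ i) (at 0)"
    by (auto intro!: derivative_eq_intros)
  from DERIV_chain2[where g="\<lambda>s. (x + s *\<^sub>R v) $ i" and x=0 and f=f, OF _ this] assms
  show ?thesis by (simp add: mult.commute)
qed

text \<open>The strict bound leaves room for the derivative of order \<open>Suc i\<close>.\<close>

lemma has_graded_derivs_alpha:
  assumes "i < n"
  shows "has_graded_derivs n False False (\<lambda>a x \<xi>. of_real ((deriv ^^ i) a (x$1)))"
proof (rule has_graded_derivs_of_real[where gt="\<lambda>a x \<xi>. (deriv ^^ Suc i) a (x$1)" and ge="\<lambda>a x \<xi>. 0"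
        and ?g1.0="\<lambda>a x \<xi>. 0" and ?g2.0="\<lambda>a x \<xi>. 0"], goal_cases)
  case 1
  show ?case by (rule graded.alpha) (use assms in simp)
next
  case (5 a x \<xi> vx v\<xi>)
  show ?case
    using DERIV_along_line[OF regular_point_facts(4)[OF 5(1), of i], of vx] by simp
qed (auto intro: graded_0)

lemma DERIV_inv_alpha:
  assumes "regular_point a x \<xi>"
  shows "((\<lambda>s. 1 / a ((x + s *\<^sub>R vx)$1)) has_real_derivative
    vx$1 * - (deriv a (x$1) * (1 / a (x$1))\<^sup>2)) (at 0)"
  by (rule DERIV_along_line[where f="\<lambda>t. 1 / a t"])
     (use regular_point_facts(1)[OF assms] regular_point_facts(4)[OF assms, of 0] in
      \<open>auto intro!: derivative_eq_intros simp: power2_eq_square\<close>)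

text \<open>With \<xi>_3 held fixed only \<eta> moves, and csc' = - csc cot stays within the
  generators.\<close>

lemma DERIV_u3:
  assumes "regular_point a x \<xi>" "v\<xi>$3 = 0"
  shows "((\<lambda>s. (\<xi> + s *\<^sub>R v\<xi>)$3 / sin ((x + s *\<^sub>R vx)$2)) has_real_derivative
    vx$2 * - (\<xi>$3 / sin (x$2) * cot (x$2))) (at 0)"
proof -
  have "((\<lambda>y. \<xi>$3 / sin y) has_real_derivative - (\<xi>$3 / sin (x$2) * cot (x$2))) (at (x$2))"
    using regular_point_facts(2)[OF assms(1)]
    by (auto intro!: derivative_eq_intros simp: cot_def)
  from DERIV_along_line[OF this, of vx] assms(2) show ?thesis by simp
qed

lemma DERIV_u4:
  assumes "regular_point a x \<xi>" "v\<xi>$4 = 0"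
  shows "((\<lambda>s. (\<xi> + s *\<^sub>R v\<xi>)$4 / cos ((x + s *\<^sub>R vx)$2)) has_real_derivative
    vx$2 * (\<xi>$4 / cos (x$2) * tan (x$2))) (at 0)"
proof -
  have "((\<lambda>y. \<xi>$4 / cos y) has_real_derivative \<xi>$4 / cos (x$2) * tan (x$2)) (at (x$2))"
    using regular_point_facts(3)[OF assms(1)]
    by (auto intro!: derivative_eq_intros simp: tan_def)
  from DERIV_along_line[OF this, of vx] assms(2) show ?thesis by simp
qed

lemma has_graded_derivs_inv_alpha:
  "has_graded_derivs (Suc n) False False (\<lambda>a x \<xi>. of_real (1 / a (x$1)))"
proof (rule has_graded_derivs_of_real[where gt="\<lambda>a x \<xi>. - (deriv a (x$1) * (1 / a (x$1))\<^sup>2)" and ge="\<lambda>a x \<xi>. 0"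
        and ?g1.0="\<lambda>a x \<xi>. 0" and ?g2.0="\<lambda>a x \<xi>. 0"], goal_cases)
  case 1
  show ?case unfolding of_real_mult of_real_minus of_real_power
    by ((simp only: not_True_eq_False not_False_eq_True)?, (rule graded_intros)+)
next
  case (5 a x \<xi> vx v\<xi>)
  show ?case using DERIV_inv_alpha[OF 5(1), of vx] by simp
qed (auto intro: graded_0)

lemma has_graded_derivs_u3:
  "has_graded_derivs n False True (\<lambda>a x \<xi>. of_real (\<xi>$3 / sin (x$2)))"
proof (rule has_graded_derivs_of_real[where gt="\<lambda>a x \<xi>. 0" and ge="\<lambda>a x \<xi>. - (\<xi>$3 / sin (x$2) * cot (x$2))"
        and ?g1.0="\<lambda>a x \<xi>. 0" and ?g2.0="\<lambda>a x \<xi>. 0"], goal_cases)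
  case 2
  show ?case unfolding of_real_mult of_real_minus
    by ((simp only: not_True_eq_False not_False_eq_True)?, (rule graded_intros)+)
next
  case (5 a x \<xi> vx v\<xi>)
  show ?case using DERIV_u3[OF 5(1,2), of vx] by simp
qed (auto intro: graded_0)

lemma has_graded_derivs_u4:
  "has_graded_derivs n False False (\<lambda>a x \<xi>. of_real (\<xi>$4 / cos (x$2)))"
proof (rule has_graded_derivs_of_real[where gt="\<lambda>a x \<xi>. 0" and ge="\<lambda>a x \<xi>. \<xi>$4 / cos (x$2) * tan (x$2)"
        and ?g1.0="\<lambda>a x \<xi>. 0" and ?g2.0="\<lambda>a x \<xi>. 0"], goal_cases)
  case 2
  show ?case unfolding of_real_mult
    by ((simp only: not_True_eq_False not_False_eq_True)?, (rule graded_intros)+)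
next
  case (5 a x \<xi> vx v\<xi>)
  show ?case using DERIV_u4[OF 5(1,3), of vx] by simp
qed (auto intro: graded_0)

text \<open>The derivative is written with \<open>1 + tan^2\<close> rather than a squared secant,
  because the secant is a generator only together with \<xi>_4.\<close>

lemma has_graded_derivs_tan:
  "has_graded_derivs n False True (\<lambda>a x \<xi>. of_real (tan (x$2)))"
proof (rule has_graded_derivs_of_real[where gt="\<lambda>a x \<xi>. 0" and ge="\<lambda>a x \<xi>. 1 + (tan (x$2))\<^sup>2"
        and ?g1.0="\<lambda>a x \<xi>. 0" and ?g2.0="\<lambda>a x \<xi>. 0"], goal_cases)
  case 2
  show ?case unfolding of_real_add of_real_power of_real_1
    by ((simp only: not_True_eq_False not_False_eq_True)?, (rule graded_intros graded.add)+)
next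
  case (5 a x \<xi> vx v\<xi>)
  have "(tan has_real_derivative 1 + (tan (x$2))\<^sup>2) (at (x$2))"
    using regular_point_facts(3)[OF 5(1)] DERIV_tan[of "x$2"] by (simp add: tan_sec power_inverse)
  from DERIV_along_line[OF this, of vx] show ?case by simp
qed (auto intro: graded_0)

lemma has_graded_derivs_cot:
  "has_graded_derivs n False True (\<lambda>a x \<xi>. of_real (cot (x$2)))"
proof (rule has_graded_derivs_of_real[where gt="\<lambda>a x \<xi>. 0" and ge="\<lambda>a x \<xi>. - 1 - (cot (x$2))\<^sup>2"
        and ?g1.0="\<lambda>a x \<xi>. 0" and ?g2.0="\<lambda>a x \<xi>. 0"], goal_cases)
  case 2
  show ?case unfolding of_real_diff of_real_minus of_real_power of_real_1
    by ((simp only: not_True_eq_False not_False_eq_True)?, (rule graded_intros)+)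
next
  case (5 a x \<xi> vx v\<xi>)
  have "- 1 - (cot (x$2))\<^sup>2 = - inverse ((sin (x$2))\<^sup>2)"
    using regular_point_facts(2)[OF 5(1)] by (simp add: cot_def power_divide cos_squared_eq field_simps)
  then have "(cot has_real_derivative - 1 - (cot (x$2))\<^sup>2) (at (x$2))"
    using regular_point_facts(2)[OF 5(1)] DERIV_cot[of "x$2"] by simp
  from DERIV_along_line[OF this, of vx] show ?case by simp
qed (auto intro: graded_0)


text \<open>The four witnesses are minus the partial derivatives of \<open>quad\<close>, times the
  square of \<open>1 / quad\<close>.\<close>

lemma has_graded_derivs_inv_quad:
  "has_graded_derivs (Suc n) False False (\<lambda>a x \<xi>. of_real (1 / quad a x \<xi>))"
proof (rule has_graded_derivs_of_real[where
        gt="\<lambda>a x \<xi>. 2 * deriv a (x$1) * (1 / a (x$1)) * (1 / a (x$1))\<^sup>2 *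
          ((\<xi>$2)\<^sup>2 + (\<xi>$3 / sin (x$2))\<^sup>2 + (\<xi>$4 / cos (x$2))\<^sup>2) * (1 / quad a x \<xi>)\<^sup>2"
        and ge="\<lambda>a x \<xi>. 2 * ((\<xi>$3 / sin (x$2))\<^sup>2 * cot (x$2) - (\<xi>$4 / cos (x$2))\<^sup>2 * tan (x$2)) *
          (1 / a (x$1))\<^sup>2 * (1 / quad a x \<xi>)\<^sup>2"
        and ?g1.0="\<lambda>a x \<xi>. - (2 * \<xi>$1 * (1 / quad a x \<xi>)\<^sup>2)"
        and ?g2.0="\<lambda>a x \<xi>. - (2 * \<xi>$2 * (1 / a (x$1))\<^sup>2 * (1 / quad a x \<xi>)\<^sup>2)"], goal_cases)
  case 1
  show ?case unfolding of_real_mult of_real_minus of_real_power of_real_add of_real_diff of_real_numeral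
    by ((simp only: not_True_eq_False not_False_eq_True)?, (rule graded_intros graded.add)+)
next
  case 2
  show ?case unfolding of_real_mult of_real_minus of_real_power of_real_add of_real_diff of_real_numeral
    by ((simp only: not_True_eq_False not_False_eq_True)?, (rule graded_intros graded.add)+)
next
  case 3
  show ?case unfolding of_real_mult of_real_minus of_real_power of_real_add of_real_diff of_real_numeral
    by ((simp only: not_True_eq_False not_False_eq_True)?, (rule graded_intros graded.add)+)
next
  case 4
  show ?case unfolding of_real_mult of_real_minus of_real_power of_real_add of_real_diff of_real_numeral
    by ((simp only: not_True_eq_False not_False_eq_True)?, (rule graded_intros graded.add)+)
next
  case (5 a x \<xi> vx v\<xi>)
  have eq: "quad a y \<zeta> = (\<zeta>$1)\<^sup>2 + ((\<zeta>$2)\<^sup>2 + (\<zeta>$3 / sin (y$2))\<^sup>2 + (\<zeta>$4 / cos (y$2))\<^sup>2) * (1 / a (y$1))\<^sup>2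
     + (\<zeta>$5)\<^sup>2 + (\<zeta>$6)\<^sup>2" for y \<zeta>
    by (simp add: quad_def power_divide)
  have "((\<lambda>s. quad a (x + s *\<^sub>R vx) (\<xi> + s *\<^sub>R v\<xi>)) has_real_derivative
      2 * \<xi>$1 * v\<xi>$1 + 2 * \<xi>$2 * v\<xi>$2 * (1 / a (x$1))\<^sup>2
      - vx$2 * 2 * ((\<xi>$3 / sin (x$2))\<^sup>2 * cot (x$2) - (\<xi>$4 / cos (x$2))\<^sup>2 * tan (x$2)) * (1 / a (x$1))\<^sup>2
      - vx$1 * 2 * deriv a (x$1) * (1 / a (x$1)) * (1 / a (x$1))\<^sup>2 *
          ((\<xi>$2)\<^sup>2 + (\<xi>$3 / sin (x$2))\<^sup>2 + (\<xi>$4 / cos (x$2))\<^sup>2)) (at 0)"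
  proof -
    have d1: "((\<lambda>s. (\<xi> + s *\<^sub>R v\<xi>)$i) has_real_derivative v\<xi>$i) (at 0)" for i
      by (auto intro!: derivative_eq_intros)
    \<comment> \<open>Naming the inner functions of s makes the derivative rules stop at them and
      use the derivatives already computed.\<close>
    define A where "A = (\<lambda>s. 1 / a ((x + s *\<^sub>R vx)$1))"
    define U where "U = (\<lambda>s. (\<xi> + s *\<^sub>R v\<xi>)$3 / sin ((x + s *\<^sub>R vx)$2))"
    define V where "V = (\<lambda>s. (\<xi> + s *\<^sub>R v\<xi>)$4 / cos ((x + s *\<^sub>R vx)$2))"
    define X where "X = (\<lambda>i s. (\<xi> + s *\<^sub>R v\<xi>)$i)"
    note [derivative_intros] = DERIV_inv_alpha[OF 5(1), of vx, folded A_def]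
      DERIV_u3[OF 5(1,2), of vx, folded U_def] DERIV_u4[OF 5(1,3), of vx, folded V_def]
    have d2 [derivative_intros]: "(X i has_real_derivative v\<xi>$i) (at 0)" for i
      unfolding X_def by (rule d1)
    have 0: "A 0 = 1 / a (x$1)" "U 0 = \<xi>$3 / sin (x$2)" "V 0 = \<xi>$4 / cos (x$2)" "X i 0 = \<xi>$i" for i
      by (auto simp: A_def U_def V_def X_def)
    have "((\<lambda>s. (X 1 s)\<^sup>2 + ((X 2 s)\<^sup>2 + (U s)\<^sup>2 + (V s)\<^sup>2) * (A s)\<^sup>2 + (X 5 s)\<^sup>2 + (X 6 s)\<^sup>2) has_real_derivative
      2 * X 1 0 * v\<xi>$1 + 2 * X 2 0 * v\<xi>$2 * (A 0)\<^sup>2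
      - vx$2 * 2 * ((U 0)\<^sup>2 * cot (x$2) - (V 0)\<^sup>2 * tan (x$2)) * (A 0)\<^sup>2
      - vx$1 * 2 * deriv a (x$1) * (A 0) * (A 0)\<^sup>2 * ((X 2 0)\<^sup>2 + (U 0)\<^sup>2 + (V 0)\<^sup>2)) (at 0)"
      apply (rule derivative_eq_intros refl)+
      unfolding 0(1)[symmetric] 0(2)[symmetric] 0(3)[symmetric]
      using 5 by (simp add: power2_eq_square algebra_simps)
    then show ?thesis unfolding eq 0 unfolding X_def A_def U_def V_def .
  qed
  from DERIV_inverse'[OF this] quad_pos[OF 5(1)]
  show ?case by (simp add: divide_inverse power2_eq_square algebra_simps)
qed

text \<open>The bound grows by one because a t-derivative of a derivative of a, of 1/a or of the
  inverse quadratic form brings in at most one further derivative of a.\<close>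

lemma graded_derivs:
  assumes "graded n \<epsilon> \<delta> g"
  shows "has_graded_derivs (Suc n) \<epsilon> \<delta> g"
  using assms
proof (induction rule: graded.induct)
  case (alpha i)
  then show ?case by (intro has_graded_derivs_alpha) simp
next
  case (add \<epsilon> \<delta> g h)
  obtain gt ge g1 g2 where g: "graded (Suc n) \<epsilon> \<delta> gt" "graded (Suc n) \<epsilon> (\<not> \<delta>) ge"
    "graded (Suc n) (\<not> \<epsilon>) \<delta> g1" "graded (Suc n) (\<not> \<epsilon>) (\<not> \<delta>) g2" "has_derivs g gt ge g1 g2"
    using add.IH(1) by (rule has_graded_derivsE)
  obtain ht he h1 h2 where h: "graded (Suc n) \<epsilon> \<delta> ht" "graded (Suc n) \<epsilon> (\<not> \<delta>) he"
    "graded (Suc n) (\<not> \<epsilon>) \<delta> h1" "graded (Suc n) (\<not> \<epsilon>) (\<not> \<delta>) h2" "has_derivs h ht he h1 h2"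
    using add.IH(2) by (rule has_graded_derivsE)
  show ?case
    by (rule has_graded_derivsI[OF _ _ _ _ has_derivs_add[OF g(5) h(5)]])
       (rule graded.add; rule g h)+
next
  case (mult \<epsilon> \<delta> g \<epsilon>' \<delta>' h \<epsilon>'' \<delta>'')
  obtain gt ge g1 g2 where g: "graded (Suc n) \<epsilon> \<delta> gt" "graded (Suc n) \<epsilon> (\<not> \<delta>) ge"
    "graded (Suc n) (\<not> \<epsilon>) \<delta> g1" "graded (Suc n) (\<not> \<epsilon>) (\<not> \<delta>) g2" "has_derivs g gt ge g1 g2"
    using mult.IH(1) by (rule has_graded_derivsE)
  obtain ht he h1 h2 where h: "graded (Suc n) \<epsilon>' \<delta>' ht" "graded (Suc n) \<epsilon>' (\<not> \<delta>') he"
    "graded (Suc n) (\<not> \<epsilon>') \<delta>' h1" "graded (Suc n) (\<not> \<epsilon>') (\<not> \<delta>') h2" "has_derivs h ht he h1 h2"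
    using mult.IH(2) by (rule has_graded_derivsE)
  \<comment> \<open>The product rule also needs the undifferentiated factors at the larger
    bound.\<close>
  have G: "graded (Suc n) \<epsilon> \<delta> g" and H: "graded (Suc n) \<epsilon>' \<delta>' h"
    using mult.hyps(1,2) by (auto elim: graded_mono)
  show ?case
    using mult.hyps(3,4)
    by (intro has_graded_derivsI[OF _ _ _ _ has_derivs_mult[OF g(5) h(5)]] graded.add
          graded.mult[OF G h(1)] graded.mult[OF g(1) H] graded.mult[OF G h(2)] graded.mult[OF g(2) H]
          graded.mult[OF G h(3)] graded.mult[OF g(3) H] graded.mult[OF G h(4)] graded.mult[OF g(4) H])
       blast+
next
  case (cong \<epsilon> \<delta> g h)
  obtain gt ge g1 g2 where g: "graded (Suc n) \<epsilon> \<delta> gt" "graded (Suc n) \<epsilon> (\<not> \<delta>) ge"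
    "graded (Suc n) (\<not> \<epsilon>) \<delta> g1" "graded (Suc n) (\<not> \<epsilon>) (\<not> \<delta>) g2" "has_derivs g gt ge g1 g2"
    using cong.IH by (rule has_graded_derivsE)
  show ?case
    by (rule has_graded_derivsI[OF g(1-4) has_derivs_cong[OF g(5)]]) (rule cong.hyps(2))
qed (rule has_graded_derivs_generators has_graded_derivs_u3 has_graded_derivs_u4 has_graded_derivs_tan
      has_graded_derivs_cot has_graded_derivs_inv_alpha has_graded_derivs_inv_quad)+

section \<open>Graded matrices\<close>

text \<open>The candidate is linear because its components are, and bounded because the domain is
  finite-dimensional; the limit is then taken componentwise.\<close>

lemma has_derivative_vec:
  fixes f :: "'a::euclidean_space \<Rightarrow> 'b::real_normed_vector^'n"
  assumes "\<And>i. ((\<lambda>x. f x $ i) has_derivative (\<lambda>h. D h $ i)) (at x within S)"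
  shows "(f has_derivative D) (at x within S)"
proof -
  have "linear D"
  proof
    show "D (u + v) = D u + D v" for u v
      using linear_add[OF has_derivative_linear[OF assms]] by (simp add: vec_eq_iff)
    show "D (r *\<^sub>R u) = r *\<^sub>R D u" for r u
      using linear_scale[OF has_derivative_linear[OF assms]] by (simp add: vec_eq_iff)
  qed
  then have "bounded_linear D"
    by (simp add: linear_conv_bounded_linear)
  moreover have "((\<lambda>y. (1 / norm (y - x)) *\<^sub>R (f y - (f x + D (y - x)))) \<longlongrightarrow> 0) (at x within S)"
    using assms by (intro vec_tendstoI) (simp add: has_derivative_within)
  ultimately show ?thesis
    by (simp add: has_derivative_within)
qed

lemma has_vector_derivative_vec:
  fixes f :: "real \<Rightarrow> 'b::real_normed_vector^'n"
  assumes "\<And>i. ((\<lambda>s. f s $ i) has_vector_derivative D $ i) (at s)"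
  shows "(f has_vector_derivative D) (at s)"
  using assms unfolding has_vector_derivative_def by (intro has_derivative_vec) simp

text \<open>Conjugation by the diagonal matrix with entries \<open>(-1)\<close> to the power \<open>parity1 k\<close>, followed by complex
  conjugation of the entries, changes the signs of \<open>\<gamma>\<^sub>1\<close> and \<open>\<gamma>\<^sub>2\<close> only; conjugation by the matrix for
  \<open>parity2\<close> changes those of \<open>\<gamma>\<^sub>2\<close> and \<open>\<gamma>\<^sub>3\<close> only. So both symmetries act on each matrix entry separately.\<close>

definition parity1 :: "4 \<Rightarrow> bool" where "parity1 k \<longleftrightarrow> k = 2 \<or> k = 3"

definition parity2 :: "4 \<Rightarrow> bool" where "parity2 k \<longleftrightarrow> k = 2 \<or> k = 4"

definition graded_matrix :: "nat \<Rightarrow> bool \<Rightarrow> bool \<Rightarrow> ((real \<Rightarrow> real) \<Rightarrow> symb) \<Rightarrow> bool" where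
  "graded_matrix n \<epsilon> \<delta> M \<longleftrightarrow> (\<forall>k l. graded n (\<epsilon> \<noteq> (parity1 k \<noteq> parity1 l)) (\<delta> \<noteq> (parity2 k \<noteq> parity2 l))
     (\<lambda>a x \<xi>. M a x \<xi> $ k $ l))"

lemma graded_matrix_mono: "graded_matrix m \<epsilon> \<delta> M \<Longrightarrow> m \<le> n \<Longrightarrow> graded_matrix n \<epsilon> \<delta> M"
  unfolding graded_matrix_def by (blast intro: graded_mono)

lemma graded_matrix_cong:
  assumes "graded_matrix n \<epsilon> \<delta> M" "\<And>a x \<xi>. regular_point a x \<xi> \<Longrightarrow> N a x \<xi> = M a x \<xi>"
  shows "graded_matrix n \<epsilon> \<delta> N"
  unfolding graded_matrix_def
  by (intro allI, rule graded.cong[OF assms(1)[unfolded graded_matrix_def, rule_format]])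
     (simp add: assms(2))

lemma graded_matrix_0: "graded_matrix n \<epsilon> \<delta> (\<lambda>a x \<xi>. 0)"
  by (simp add: graded_matrix_def graded_0)

lemma graded_matrix_add:
  "graded_matrix n \<epsilon> \<delta> M \<Longrightarrow> graded_matrix n \<epsilon> \<delta> N \<Longrightarrow> graded_matrix n \<epsilon> \<delta> (\<lambda>a x \<xi>. M a x \<xi> + N a x \<xi>)"
  by (simp add: graded_matrix_def graded.add)

lemma graded_matrix_uminus:
  "graded_matrix n \<epsilon> \<delta> M \<Longrightarrow> graded_matrix n \<epsilon> \<delta> (\<lambda>a x \<xi>. - M a x \<xi>)"
  by (simp add: graded_matrix_def graded_uminus)

lemma graded_matrix_diff:
  "graded_matrix n \<epsilon> \<delta> M \<Longrightarrow> graded_matrix n \<epsilon> \<delta> N \<Longrightarrow> graded_matrix n \<epsilon> \<delta> (\<lambda>a x \<xi>. M a x \<xi> - N a x \<xi>)"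
  by (simp add: graded_matrix_def graded_diff)

lemma graded_matrix_sum:
  "(\<And>i. i \<in> A \<Longrightarrow> graded_matrix n \<epsilon> \<delta> (M i)) \<Longrightarrow> graded_matrix n \<epsilon> \<delta> (\<lambda>a x \<xi>. \<Sum>i\<in>A. M i a x \<xi>)"
  by (induction A rule: infinite_finite_induct) (auto intro: graded_matrix_add graded_matrix_0)

text \<open>The parity of the summation index occurs twice and cancels.\<close>

lemma graded_matrix_mult:
  assumes "graded_matrix n \<epsilon> \<delta> M" "graded_matrix n \<epsilon>' \<delta>' N" "\<epsilon>'' = (\<epsilon> \<noteq> \<epsilon>')" "\<delta>'' = (\<delta> \<noteq> \<delta>')"
  shows "graded_matrix n \<epsilon>'' \<delta>'' (\<lambda>a x \<xi>. M a x \<xi> ** N a x \<xi>)"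
  unfolding graded_matrix_def matrix_matrix_mult_def vec_lambda_beta
proof (intro allI graded_sum)
  fix k l m :: 4
  show "graded n (\<epsilon>'' \<noteq> (parity1 k \<noteq> parity1 l)) (\<delta>'' \<noteq> (parity2 k \<noteq> parity2 l))
      (\<lambda>a x \<xi>. M a x \<xi> $ k $ m * N a x \<xi> $ m $ l)"
    by (rule graded.mult[OF assms(1,2)[unfolded graded_matrix_def, rule_format]])
       (use assms(3,4) in auto)
qed

lemma graded_matrix_mat:
  "graded n \<epsilon> \<delta> c \<Longrightarrow> graded_matrix n \<epsilon> \<delta> (\<lambda>a x \<xi>. mat (c a x \<xi>))"
  unfolding graded_matrix_def
proof (intro allI)
  fix k l :: 4
  assume "graded n \<epsilon> \<delta> c"
  then show "graded n (\<epsilon> \<noteq> (parity1 k \<noteq> parity1 l)) (\<delta> \<noteq> (parity2 k \<noteq> parity2 l))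
      (\<lambda>a x \<xi>. mat (c a x \<xi>) $ k $ l)"
    by (cases "k = l") (simp_all add: mat_def graded_0)
qed

lemma not_xor: "((\<not> p) \<noteq> q) = (\<not> (p \<noteq> q))"
  by blast

text \<open>The equalities are confined to regular points, since elsewhere
  \<open>vector_derivative\<close> may be an unspecified value.\<close>

lemma graded_matrix_has_derivs:
  assumes "graded_matrix n \<epsilon> \<delta> M"
  obtains Mt Me M1 M2 where "graded_matrix (Suc n) \<epsilon> \<delta> Mt" "graded_matrix (Suc n) \<epsilon> (\<not> \<delta>) Me"
    "graded_matrix (Suc n) (\<not> \<epsilon>) \<delta> M1" "graded_matrix (Suc n) (\<not> \<epsilon>) (\<not> \<delta>) M2"
    "\<forall>a x \<xi>. regular_point a x \<xi> \<longrightarrow> d_x 1 (M a) x \<xi> = Mt a x \<xi> \<and> d_x 2 (M a) x \<xi> = Me a x \<xi> \<and>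
       d_x 3 (M a) x \<xi> = 0 \<and> d_x 4 (M a) x \<xi> = 0 \<and> d_xi 1 (M a) x \<xi> = M1 a x \<xi> \<and> d_xi 2 (M a) x \<xi> = M2 a x \<xi>"
proof -
  let ?\<epsilon> = "\<lambda>k l. \<epsilon> \<noteq> (parity1 k \<noteq> parity1 l)" and ?\<delta> = "\<lambda>k l. \<delta> \<noteq> (parity2 k \<noteq> parity2 l)"
  \<comment> \<open>One tuple of families per entry, so that a single choice over \<open>k\<close>
    and \<open>l\<close> provides all four.\<close>
  define P where "P k l G \<longleftrightarrow> (case G of (gt, ge, g1, g2) \<Rightarrow> graded (Suc n) (?\<epsilon> k l) (?\<delta> k l) gt \<and>
      graded (Suc n) (?\<epsilon> k l) (\<not> ?\<delta> k l) ge \<and>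
      graded (Suc n) (\<not> ?\<epsilon> k l) (?\<delta> k l) g1 \<and> graded (Suc n) (\<not> ?\<epsilon> k l) (\<not> ?\<delta> k l) g2 \<and>
      has_derivs (\<lambda>a x \<xi>. M a x \<xi> $ k $ l) gt ge g1 g2)" for k l G
  have "\<exists>G. P k l G" for k l
  proof -
    obtain gt ge g1 g2 where "graded (Suc n) (?\<epsilon> k l) (?\<delta> k l) gt"
      "graded (Suc n) (?\<epsilon> k l) (\<not> ?\<delta> k l) ge" "graded (Suc n) (\<not> ?\<epsilon> k l) (?\<delta> k l) g1"
      "graded (Suc n) (\<not> ?\<epsilon> k l) (\<not> ?\<delta> k l) g2" "has_derivs (\<lambda>a x \<xi>. M a x \<xi> $ k $ l) gt ge g1 g2"
      using graded_derivs[OF assms[unfolded graded_matrix_def, rule_format, of k l]]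
      by (rule has_graded_derivsE)
    then show ?thesis unfolding P_def by (intro exI[of _ "(gt, ge, g1, g2)"]) simp
  qed
  then obtain G where PG: "P k l (G k l)" for k l by metis
  define gt ge g1 g2 where "gt = (\<lambda>k l. fst (G k l))" and "ge = (\<lambda>k l. fst (snd (G k l)))"
    and "g1 = (\<lambda>k l. fst (snd (snd (G k l))))" and "g2 = (\<lambda>k l. snd (snd (snd (G k l))))"
  have G: "graded (Suc n) (?\<epsilon> k l) (?\<delta> k l) (gt k l)"
      "graded (Suc n) (?\<epsilon> k l) (\<not> ?\<delta> k l) (ge k l)"
      "graded (Suc n) (\<not> ?\<epsilon> k l) (?\<delta> k l) (g1 k l)" "graded (Suc n) (\<not> ?\<epsilon> k l) (\<not> ?\<delta> k l) (g2 k l)"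
      "has_derivs (\<lambda>a x \<xi>. M a x \<xi> $ k $ l) (gt k l) (ge k l) (g1 k l) (g2 k l)" for k l
    using PG[of k l] by (simp_all add: P_def gt_def ge_def g1_def g2_def split_beta)
  have D: "vector_derivative (\<lambda>s. M a (x + s *\<^sub>R vx) (\<xi> + s *\<^sub>R v\<xi>)) (at 0) = (\<chi> k l.
         of_real (vx$1) * gt k l a x \<xi> + of_real (vx$2) * ge k l a x \<xi>
         + of_real (v\<xi>$1) * g1 k l a x \<xi> + of_real (v\<xi>$2) * g2 k l a x \<xi>)"
    if "regular_point a x \<xi>" "v\<xi>$3 = 0" "v\<xi>$4 = 0" "v\<xi>$5 = 0" "v\<xi>$6 = 0" for a x \<xi> vx v\<xi>
    using G(5)[unfolded has_derivs_def, rule_format, OF that]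
    by (intro vector_derivative_at has_vector_derivative_vec) simp
  have der: "d_x 1 (M a) x \<xi> = (\<chi> k l. gt k l a x \<xi>)" "d_x 2 (M a) x \<xi> = (\<chi> k l. ge k l a x \<xi>)"
      "d_x 3 (M a) x \<xi> = 0" "d_x 4 (M a) x \<xi> = 0"
      "d_xi 1 (M a) x \<xi> = (\<chi> k l. g1 k l a x \<xi>)" "d_xi 2 (M a) x \<xi> = (\<chi> k l. g2 k l a x \<xi>)"
    if r: "regular_point a x \<xi>" for a x \<xi>
  proof -
    \<comment> \<open>The general direction is specialised to a pure x-direction and a pure
      \<xi>-direction. The formula contains no \<open>vx$3\<close> or \<open>vx$4\<close>, so the
      derivatives in the last two coordinates vanish.\<close>
    note Dx = D[OF r, where v\<xi>=0, simplified] and D\<xi> = D[OF r, where vx=0, simplified]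
    show "d_x 1 (M a) x \<xi> = (\<chi> k l. gt k l a x \<xi>)" "d_x 2 (M a) x \<xi> = (\<chi> k l. ge k l a x \<xi>)"
      "d_x 3 (M a) x \<xi> = 0" "d_x 4 (M a) x \<xi> = 0"
      by (simp_all add: d_x_def Dx axis_def vec_eq_iff)
    show "d_xi 1 (M a) x \<xi> = (\<chi> k l. g1 k l a x \<xi>)" "d_xi 2 (M a) x \<xi> = (\<chi> k l. g2 k l a x \<xi>)"
      by (simp_all add: d_xi_def D\<xi> axis_def vec_eq_iff)
  qed
  have gr: "graded_matrix (Suc n) \<epsilon> \<delta> (\<lambda>a x \<xi>. \<chi> k l. gt k l a x \<xi>)"
    "graded_matrix (Suc n) \<epsilon> (\<not> \<delta>) (\<lambda>a x \<xi>. \<chi> k l. ge k l a x \<xi>)"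
    "graded_matrix (Suc n) (\<not> \<epsilon>) \<delta> (\<lambda>a x \<xi>. \<chi> k l. g1 k l a x \<xi>)"
    "graded_matrix (Suc n) (\<not> \<epsilon>) (\<not> \<delta>) (\<lambda>a x \<xi>. \<chi> k l. g2 k l a x \<xi>)"
    unfolding graded_matrix_def vec_lambda_beta not_xor using G(1-4) by simp_all
  show thesis
    by (rule that[OF gr]) (use der in blast)
qed

lemma graded_matrix_d_x:
  assumes "graded_matrix n \<epsilon> \<delta> M"
  shows "graded_matrix (Suc n) \<epsilon> \<delta> (\<lambda>a. d_x 1 (M a))" "graded_matrix (Suc n) \<epsilon> (\<not> \<delta>) (\<lambda>a. d_x 2 (M a))"
    "graded_matrix (Suc n) (\<not> \<epsilon>) \<delta> (\<lambda>a. d_xi 1 (M a))"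
    "graded_matrix (Suc n) (\<not> \<epsilon>) (\<not> \<delta>) (\<lambda>a. d_xi 2 (M a))"
    "regular_point a x \<xi> \<Longrightarrow> d_x 3 (M a) x \<xi> = 0" "regular_point a x \<xi> \<Longrightarrow> d_x 4 (M a) x \<xi> = 0"
proof -
  obtain Mt Me M1 M2 where g: "graded_matrix (Suc n) \<epsilon> \<delta> Mt" "graded_matrix (Suc n) \<epsilon> (\<not> \<delta>) Me"
    "graded_matrix (Suc n) (\<not> \<epsilon>) \<delta> M1" "graded_matrix (Suc n) (\<not> \<epsilon>) (\<not> \<delta>) M2" and
    eq: "\<forall>a x \<xi>. regular_point a x \<xi> \<longrightarrow> d_x 1 (M a) x \<xi> = Mt a x \<xi> \<and> d_x 2 (M a) x \<xi> = Me a x \<xi> \<and>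
       d_x 3 (M a) x \<xi> = 0 \<and> d_x 4 (M a) x \<xi> = 0 \<and> d_xi 1 (M a) x \<xi> = M1 a x \<xi> \<and> d_xi 2 (M a) x \<xi> = M2 a x \<xi>"
    using assms by (rule graded_matrix_has_derivs)
  show "graded_matrix (Suc n) \<epsilon> \<delta> (\<lambda>a. d_x 1 (M a))"
    by (rule graded_matrix_cong[OF g(1)]) (use eq in blast)
  show "graded_matrix (Suc n) \<epsilon> (\<not> \<delta>) (\<lambda>a. d_x 2 (M a))"
    by (rule graded_matrix_cong[OF g(2)]) (use eq in blast)
  show "graded_matrix (Suc n) (\<not> \<epsilon>) \<delta> (\<lambda>a. d_xi 1 (M a))"
    by (rule graded_matrix_cong[OF g(3)]) (use eq in blast)
  show "graded_matrix (Suc n) (\<not> \<epsilon>) (\<not> \<delta>) (\<lambda>a. d_xi 2 (M a))"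
    by (rule graded_matrix_cong[OF g(4)]) (use eq in blast)
  show "regular_point a x \<xi> \<Longrightarrow> d_x 3 (M a) x \<xi> = 0" "regular_point a x \<xi> \<Longrightarrow> d_x 4 (M a) x \<xi> = 0"
    using eq by blast+
qed

lemma graded_matrix_d_x_funpow:
  assumes "graded_matrix n \<epsilon> \<delta> M"
  shows "graded_matrix (n + k) \<epsilon> \<delta> (\<lambda>a. (d_x 1 ^^ k) (M a))"
    "graded_matrix (n + k) \<epsilon> (\<delta> \<noteq> odd k) (\<lambda>a. (d_x 2 ^^ k) (M a))"
    "graded_matrix (n + k) (\<epsilon> \<noteq> odd k) \<delta> (\<lambda>a. (d_xi 1 ^^ k) (M a))"
    "graded_matrix (n + k) (\<epsilon> \<noteq> odd k) (\<delta> \<noteq> odd k) (\<lambda>a. (d_xi 2 ^^ k) (M a))"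
proof (induction k)
  case (Suc k)
  show "graded_matrix (n + Suc k) \<epsilon> \<delta> (\<lambda>a. (d_x 1 ^^ Suc k) (M a))"
    using graded_matrix_d_x(1)[OF Suc(1)] by simp
  show "graded_matrix (n + Suc k) \<epsilon> (\<delta> \<noteq> odd (Suc k)) (\<lambda>a. (d_x 2 ^^ Suc k) (M a))"
    using graded_matrix_d_x(2)[OF Suc(2)] by simp
  show "graded_matrix (n + Suc k) (\<epsilon> \<noteq> odd (Suc k)) \<delta> (\<lambda>a. (d_xi 1 ^^ Suc k) (M a))"
    using graded_matrix_d_x(3)[OF Suc(3)] by simp
  show "graded_matrix (n + Suc k) (\<epsilon> \<noteq> odd (Suc k)) (\<delta> \<noteq> odd (Suc k)) (\<lambda>a. (d_xi 2 ^^ Suc k) (M a))"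
    using graded_matrix_d_x(4)[OF Suc(4)] by simp
qed (use assms in simp_all)

text \<open>Both \<xi>_1 and \<xi>_2 flip the first parity, hence \<open>mi_size \<beta>\<close>;
  only \<eta> and \<xi>_2 flip the second, hence \<open>\<beta>$2\<close>.\<close>

lemma graded_matrix_D:
  assumes "graded_matrix n \<epsilon> \<delta> M" "\<beta>$3 = 0" "\<beta>$4 = 0"
  shows "graded_matrix (n + mi_size \<beta>) \<epsilon> (\<delta> \<noteq> odd (\<beta>$2)) (\<lambda>a. D_x \<beta> (M a))"
    "graded_matrix (n + mi_size \<beta>) (\<epsilon> \<noteq> odd (mi_size \<beta>)) (\<delta> \<noteq> odd (\<beta>$2)) (\<lambda>a. D_xi \<beta> (M a))"
proof -
  \<comment> \<open>The summands are ordered as the derivatives are nested, with the second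
    coordinate innermost.\<close>
  have s: "mi_size \<beta> = \<beta>$2 + \<beta>$1"
    using assms(2,3) by (simp add: mi_size_def sum_4)
  show "graded_matrix (n + mi_size \<beta>) \<epsilon> (\<delta> \<noteq> odd (\<beta>$2)) (\<lambda>a. D_x \<beta> (M a))"
    unfolding s add.assoc[symmetric] D_x_def assms(2,3) funpow_0
    by (rule graded_matrix_d_x_funpow(1)[OF graded_matrix_d_x_funpow(2)[OF assms(1)]])
  have e1: "(\<epsilon> \<noteq> odd (mi_size \<beta>)) = ((\<epsilon> \<noteq> odd (\<beta>$2)) \<noteq> odd (\<beta>$1))"
    unfolding s even_add by blast
  have e2: "n + mi_size \<beta> = n + \<beta>$2 + \<beta>$1"
    unfolding s by simp
  show "graded_matrix (n + mi_size \<beta>) (\<epsilon> \<noteq> odd (mi_size \<beta>)) (\<delta> \<noteq> odd (\<beta>$2)) (\<lambda>a. D_xi \<beta> (M a))"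
    unfolding e1 e2 D_xi_def assms(2,3) funpow_0
    by (rule graded_matrix_d_x_funpow(3)[OF graded_matrix_d_x_funpow(4)[OF assms(1)]])
qed

text \<open>Nearby points on the line are regular as well, so the function vanishes along a piece of
  it.\<close>

lemma d_x_vanishing:
  assumes "\<And>x \<xi>. regular_point a x \<xi> \<Longrightarrow> F x \<xi> = 0" "regular_point a x \<xi>"
  shows "d_x j F x \<xi> = 0"
proof -
  have "((\<lambda>s. F (x + s *\<^sub>R axis (of_nat j) 1) \<xi>) has_vector_derivative 0) (at 0)"
    unfolding has_vector_derivative_def
    by (rule has_derivative_transform_eventually[where f="\<lambda>_. 0"])
       (use eventually_regular_point[OF assms(2), of "axis (of_nat j) 1" 0] assms in
         \<open>auto elim!: eventually_mono\<close>)
  then show ?thesis by (simp add: d_x_def vector_derivative_at)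
qed

lemma d_x_funpow_vanishing:
  assumes "\<And>x \<xi>. regular_point a x \<xi> \<Longrightarrow> F x \<xi> = 0" "regular_point a x \<xi>"
  shows "(d_x j ^^ k) F x \<xi> = 0"
  using assms(2) by (induction k arbitrary: x \<xi>) (auto intro: d_x_vanishing[where a=a] assms(1))

text \<open>The innermost derivatives are those in the angles and give zero at every regular point;
  the outer ones preserve this. It removes the terms of the parametrix that contain a derivative in
  \<xi>_3 or \<xi>_4.\<close>

lemma D_x_vanishing:
  assumes "graded_matrix n \<epsilon> \<delta> M" "\<beta>$3 \<noteq> 0 \<or> \<beta>$4 \<noteq> 0" "regular_point a x \<xi>"
  shows "D_x \<beta> (M a) x \<xi> = 0"
proof -
  have "(d_x 3 ^^ \<beta>$3) ((d_x 4 ^^ \<beta>$4) (M a)) y \<zeta> = 0" if "regular_point a y \<zeta>" for y \<zeta>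
  proof (cases "\<beta>$4")
    case 0
    then obtain m where "\<beta>$3 = Suc m" using assms(2) by (metis not0_implies_Suc)
    with 0 that graded_matrix_d_x(5)[OF assms(1)] show ?thesis
      by (simp add: funpow_Suc_right d_x_funpow_vanishing[where a=a] del: funpow.simps)
  next
    case (Suc m)
    with that graded_matrix_d_x(6)[OF assms(1)] show ?thesis
      by (auto intro!: d_x_funpow_vanishing[where a=a] simp: funpow_Suc_right simp del: funpow.simps)
  qed
  then have "(d_x 2 ^^ \<beta>$2) ((d_x 3 ^^ \<beta>$3) ((d_x 4 ^^ \<beta>$4) (M a))) y \<zeta> = 0" if "regular_point a y \<zeta>" for y \<zeta>
    using that by (rule d_x_funpow_vanishing)
  then show ?thesis
    unfolding D_x_def using assms(3) by (rule d_x_funpow_vanishing)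
qed

section \<open>Symbols of the parametrix\<close>

text \<open>The entries in terms of the generators, with divisions turned into products, so that
  resolution can read off their parities.\<close>

lemma A1_entries:
  "A1 a x \<xi> $ 1 $ 1 = \<i> * of_real (\<xi>$4 / cos (x$2)) * of_real (1 / a (x$1)) - of_real (\<xi>$1)"
  "A1 a x \<xi> $ 1 $ 2 = (\<i> * of_real (\<xi>$2) + of_real (\<xi>$3 / sin (x$2))) * of_real (1 / a (x$1))"
  "A1 a x \<xi> $ 2 $ 1 = (\<i> * of_real (\<xi>$2) - of_real (\<xi>$3 / sin (x$2))) * of_real (1 / a (x$1))"
  "A1 a x \<xi> $ 2 $ 2 = - of_real (\<xi>$1) - \<i> * of_real (\<xi>$4 / cos (x$2)) * of_real (1 / a (x$1))"
  by (simp_all add: A1_def Let_def vector_2)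

lemma B1_entries:
  "B1 a x \<xi> $ 1 $ 1 = - of_real (\<xi>$1) - \<i> * of_real (\<xi>$4 / cos (x$2)) * of_real (1 / a (x$1))"
  "B1 a x \<xi> $ 1 $ 2 = (- (\<i> * of_real (\<xi>$2)) - of_real (\<xi>$3 / sin (x$2))) * of_real (1 / a (x$1))"
  "B1 a x \<xi> $ 2 $ 1 = (of_real (\<xi>$3 / sin (x$2)) - \<i> * of_real (\<xi>$2)) * of_real (1 / a (x$1))"
  "B1 a x \<xi> $ 2 $ 2 = \<i> * of_real (\<xi>$4 / cos (x$2)) * of_real (1 / a (x$1)) - of_real (\<xi>$1)"
  by (simp_all add: B1_def Let_def vector_2)

lemma A0_entries:
  "A0 a x $ 1 $ 1 = of_rat (3/2) * \<i> * of_real (deriv a (x$1)) * of_real (1 / a (x$1))"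
  "A0 a x $ 1 $ 2 = of_rat (1/2) * (of_real (cot (x$2)) - of_real (tan (x$2))) * of_real (1 / a (x$1))"
  "A0 a x $ 2 $ 1 = of_rat (1/2) * (of_real (cot (x$2)) - of_real (tan (x$2))) * of_real (1 / a (x$1))"
  "A0 a x $ 2 $ 2 = of_rat (3/2) * \<i> * of_real (deriv a (x$1)) * of_real (1 / a (x$1))"
  by (simp_all add: A0_def Let_def vector_2 of_rat_divide)

lemma B0_entries:
  "B0 a x $ 1 $ 1 = of_rat (3/2) * \<i> * of_real (deriv a (x$1)) * of_real (1 / a (x$1))"
  "B0 a x $ 1 $ 2 = of_rat (1/2) * (of_real (tan (x$2)) - of_real (cot (x$2))) * of_real (1 / a (x$1))"
  "B0 a x $ 2 $ 1 = of_rat (1/2) * (of_real (tan (x$2)) - of_real (cot (x$2))) * of_real (1 / a (x$1))"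
  "B0 a x $ 2 $ 2 = of_rat (3/2) * \<i> * of_real (deriv a (x$1)) * of_real (1 / a (x$1))"
  by (simp_all add: B0_def Let_def vector_2 of_rat_divide)

lemma offdiag_entries:
  "offdiag A B $ 1 $ 1 = 0" "offdiag A B $ 1 $ 2 = 0" "offdiag A B $ 1 $ 3 = A$1$1" "offdiag A B $ 1 $ 4 = A$1$2"
  "offdiag A B $ 2 $ 1 = 0" "offdiag A B $ 2 $ 2 = 0" "offdiag A B $ 2 $ 3 = A$2$1" "offdiag A B $ 2 $ 4 = A$2$2"
  "offdiag A B $ 3 $ 1 = B$1$1" "offdiag A B $ 3 $ 2 = B$1$2" "offdiag A B $ 3 $ 3 = 0" "offdiag A B $ 3 $ 4 = 0"
  "offdiag A B $ 4 $ 1 = B$2$1" "offdiag A B $ 4 $ 2 = B$2$2" "offdiag A B $ 4 $ 3 = 0" "offdiag A B $ 4 $ 4 = 0"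
  unfolding offdiag_def by (simp_all only: vector_4_nth)

lemma parity_table:
  "parity1 1 = False" "parity1 2 = True" "parity1 3 = True" "parity1 4 = False"
  "parity2 1 = False" "parity2 2 = True" "parity2 3 = False" "parity2 4 = True"
  by (simp_all add: parity1_def parity2_def)

lemma xor_table: "(False \<noteq> False) = False" "(False \<noteq> True) = True" "(True \<noteq> False) = True" "(True \<noteq> True) = False"
  by simp_all

text \<open>All sixteen entries are checked against the index parities; the behaviour of the
  Clifford generators under the two symmetries enters here.\<close>

lemma graded_q1: "graded_matrix n False False q1"
  unfolding graded_matrix_def forall_4 parity_table xor_table q1_def offdiag_entries A1_entries B1_entries
  by (intro conjI; (rule graded_intros graded.add)+)

lemma graded_q0: "graded_matrix (Suc n) False False q0"
  unfolding graded_matrix_def forall_4 parity_table xor_table q0_def offdiag_entries A0_entries B0_entries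
  by (intro conjI; (rule graded_intros graded.add)+)

text \<open>The factor \<open>\<i>\<close> restores the first parity changed by the
  \<xi>-derivative, and for j = 2 the second parity is changed in both factors.\<close>

lemma graded_matrix_symbol_composition:
  assumes "graded_matrix m False False M" "graded_matrix n False False N" "m \<le> n"
  shows "graded_matrix (Suc n) False False
    (\<lambda>a x \<xi>. mat \<i> ** (\<Sum>j=1..4. d_xi j (M a) x \<xi> ** d_x j (N a) x \<xi>))"
proof -
  have "graded_matrix (Suc n) True False
      (\<lambda>a x \<xi>. d_xi 1 (M a) x \<xi> ** d_x 1 (N a) x \<xi> + d_xi 2 (M a) x \<xi> ** d_x 2 (N a) x \<xi>)"
    by (intro graded_matrix_add
          graded_matrix_mult[OF graded_matrix_d_x(3)[OF graded_matrix_mono[OF assms(1,3)]] graded_matrix_d_x(1)[OF assms(2)]]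
          graded_matrix_mult[OF graded_matrix_d_x(4)[OF graded_matrix_mono[OF assms(1,3)]] graded_matrix_d_x(2)[OF assms(2)]])
       simp_all
  then have "graded_matrix (Suc n) True False (\<lambda>a x \<xi>. \<Sum>j=1..4. d_xi j (M a) x \<xi> ** d_x j (N a) x \<xi>)"
  proof (rule graded_matrix_cong)
    fix a x \<xi> assume "regular_point a x \<xi>"
    then show "(\<Sum>j=1..4. d_xi j (M a) x \<xi> ** d_x j (N a) x \<xi>) =
        d_xi 1 (M a) x \<xi> ** d_x 1 (N a) x \<xi> + d_xi 2 (M a) x \<xi> ** d_x 2 (N a) x \<xi>"
      using graded_matrix_d_x(5,6)[OF assms(2)] by (simp add: eval_nat_numeral)
  qed
  then show ?thesis
    by (rule graded_matrix_mult[OF graded_matrix_mat[OF graded.imag]]) simp_all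
qed

text \<open>The bound counts derivatives of a: none in \<open>p2\<close>, one in \<open>p1\<close>,
  two in \<open>p0\<close>. It complements the order k in the weight condition of the
  recursion.\<close>

lemma graded_p_symbol:
  assumes "k \<le> 2"
  shows "graded_matrix (2 - k) False False (\<lambda>a. p_symbol a k)"
proof -
  have 2: "graded_matrix 0 False False p2"
    unfolding p2_def by (rule graded_matrix_mult[OF graded_q1 graded_q1]) simp_all
  have 1: "graded_matrix (Suc 0) False False p1"
    unfolding p1_def
    by (intro graded_matrix_diff graded_matrix_add graded_matrix_symbol_composition
          graded_matrix_mult[OF graded_q1 graded_q0] graded_matrix_mult[OF graded_q0 graded_q1] graded_q1) simp_all
  have 0: "graded_matrix (Suc (Suc 0)) False False p0"
    unfolding p0_def
    by (intro graded_matrix_diff graded_matrix_symbol_composition[where m=0]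
          graded_matrix_mult[OF graded_q0 graded_q0] graded_q1 graded_q0) simp_all
  from assms consider "k = 0" | "k = 1" | "k = 2" by linarith
  then show ?thesis using 0 1 2 by cases (simp_all add: p_symbol_def numeral_2_eq_2)
qed

lemma matrix_inv_eqI:
  fixes A :: "'a::semiring_1^'n^'m"
  assumes "A ** B = mat 1" "B ** A = mat 1"
  shows "matrix_inv A = B"
  unfolding matrix_inv_def
proof (rule some_equality)
  fix C assume "A ** C = mat 1 \<and> C ** A = mat 1"
  then have "C = C ** (A ** B)" "(C ** A) ** B = B" by (simp_all add: assms)
  then show "C = B" by (simp add: matrix_mul_assoc)
qed (use assms in simp)

text \<open>By the Clifford relations, in the form \<open>p2_eq\<close>, the matrix to be inverted
  is scalar.\<close>

lemma sigma_0_eq: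
  assumes "regular_point a x \<xi>"
  shows "sigma a 0 x \<xi> = mat (of_real (1 / quad a x \<xi>))"
proof -
  have "p2 a x \<xi> + mat (of_real ((\<xi>$5)\<^sup>2 + (\<xi>$6)\<^sup>2)) = mat (of_real (quad a x \<xi>))"
    by (simp add: p2_eq quad_def vec_eq_iff mat_def power_divide)
  moreover have "mat (of_real (quad a x \<xi>)) ** mat (of_real (1 / quad a x \<xi>)) = (mat 1 :: complex^4^4)"
    "mat (of_real (1 / quad a x \<xi>)) ** mat (of_real (quad a x \<xi>)) = (mat 1 :: complex^4^4)"
    using quad_pos[OF assms]
    by (simp_all add: matrix_matrix_mult_def mat_def vec_eq_iff forall_4 sum_4)
  ultimately show ?thesis
    by (simp add: matrix_inv_eqI)
qed

text \<open>In each term of the recursion the power of \<open>\<i>\<close> compensates the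
  \<xi>-derivatives in the first parity, and the derivatives in \<xi>_2 and \<eta> compensate each
  other in the second.\<close>

lemma graded_sigma: "graded_matrix N False False (\<lambda>a. sigma a N)"
proof (induction N rule: less_induct)
  case (less N)
  have s0: "graded_matrix n False False (\<lambda>a. sigma a 0)" for n
    by (rule graded_matrix_cong[OF graded_matrix_mat[OF graded.inv_quad]]) (rule sigma_0_eq)
  show ?case
  proof (cases N)
    case 0
    with s0 show ?thesis by simp
  next
    case (Suc M)
    have "graded_matrix (Suc M) False False (\<lambda>a x \<xi>. mat ((- \<i>) ^ mi_size \<beta> / mi_fact \<beta>) **
          (D_xi \<beta> (sigma a j) x \<xi> ** D_x \<beta> (p_symbol a k) x \<xi>))"
      if j: "j < Suc M" and k: "k \<le> 2"
        and b: "- 2 - int j - int (mi_size \<beta>) + int k = - int (Suc M)" for j k and \<beta> :: "nat^4"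
    proof (cases "\<beta>$3 = 0 \<and> \<beta>$4 = 0")
      \<comment> \<open>A derivative in an angle falls on \<open>p_symbol\<close>, which does not
        depend on the angles.\<close>
      case False
      show ?thesis
        by (rule graded_matrix_cong[OF graded_matrix_0])
           (use D_x_vanishing[OF graded_p_symbol[OF k]] False in simp)
    next
      case True
      have j': "graded_matrix j False False (\<lambda>a. sigma a j)"
        using less[of j] j Suc by simp
      let ?m = "mi_size \<beta>"
      \<comment> \<open>The weight condition reads j + |\<beta>| + (2 - k) = N, so both factors stay
        within the order N.\<close>
      have le: "j + ?m \<le> Suc M" "2 - k + ?m \<le> Suc M"
        using b k j by linarith+
      have sz: "odd ?m = (odd (\<beta>$1) \<noteq> odd (\<beta>$2))"
        using True by (simp add: mi_size_def sum_4)
      \<comment> \<open>The factorial is a positive integer, so its inverse is a rational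
        constant.\<close>
      define K :: nat where "K = (\<Prod>i\<in>UNIV. fact (\<beta>$i))"
      have K: "mi_fact \<beta> = of_nat K"
        by (simp add: K_def mi_fact_def)
      have "graded (Suc M) (odd ?m) False (\<lambda>a x \<xi>. (- \<i>) ^ ?m * of_rat (1 / of_nat K))"
        using graded_power[OF graded_uminus[OF graded.imag[of "Suc M"]], of ?m]
        by (intro graded.mult[OF _ graded.rat]) auto
      then have c: "graded (Suc M) (odd ?m) False (\<lambda>a x \<xi>. (- \<i>) ^ ?m / mi_fact \<beta>)"
        by (simp add: K of_rat_divide)
      have D1: "graded_matrix (Suc M) (odd ?m) (odd (\<beta>$2)) (\<lambda>a. D_xi \<beta> (sigma a j))"
        using graded_matrix_mono[OF graded_matrix_D(2)[OF j'] le(1)] True by simp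
      have D2: "graded_matrix (Suc M) False (odd (\<beta>$2)) (\<lambda>a. D_x \<beta> (p_symbol a k))"
        using graded_matrix_mono[OF graded_matrix_D(1)[OF graded_p_symbol[OF k]] le(2)] True by simp
      show ?thesis
        by (rule graded_matrix_mult[OF graded_matrix_mat[OF c] graded_matrix_mult[OF D1 D2 refl refl]]) auto
    qed
    then show ?thesis
      unfolding Suc sigma.simps(2)
      by (intro graded_matrix_uminus graded_matrix_mult[OF _ s0] graded_matrix_sum) auto
  qed
qed

text \<open>On the diagonal the index parities cancel.\<close>

lemma graded_trace:
  assumes "graded_matrix n \<epsilon> \<delta> M"
  shows "graded n \<epsilon> \<delta> (\<lambda>a x \<xi>. trace (M a x \<xi>))"
  unfolding trace_def
  by (rule graded_sum) (use assms[unfolded graded_matrix_def, rule_format, of i i for i] in simp)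

section \<open>Monomials and even parts\<close>

definition hopf_u :: "real^4 \<Rightarrow> real^6 \<Rightarrow> 6 \<Rightarrow> real" where
  "hopf_u x \<xi> i = (if i = 3 then \<xi>$3 / sin (x$2) else if i = 4 then \<xi>$4 / cos (x$2) else \<xi>$i)"

definition jet :: "(real \<Rightarrow> real) \<Rightarrow> real^4 \<Rightarrow> 4 \<Rightarrow> real" where
  "jet a x i = (if i = 1 then deriv a (x$1) else if i = 2 then (deriv ^^ 2) a (x$1)
     else if i = 3 then (deriv ^^ 3) a (x$1) else (deriv ^^ 4) a (x$1))"

text \<open>Powers of a and 1/a, and of tan and cot, are kept apart, so that multiplication merely
  adds exponents, without side conditions.\<close>

definition monomial_family ::
  "rat \<Rightarrow> nat \<Rightarrow> (6 \<Rightarrow> nat) \<Rightarrow> nat \<Rightarrow> nat \<Rightarrow> (4 \<Rightarrow> nat) \<Rightarrow> nat \<Rightarrow> nat \<Rightarrow> nat \<Rightarrow> family" where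
  "monomial_family c j e p r b h k l = (\<lambda>a x \<xi>. of_rat c * \<i> ^ j * (\<Prod>i\<in>UNIV. of_real (hopf_u x \<xi> i) ^ e i) *
     of_real (a (x$1)) ^ p * of_real (1 / a (x$1)) ^ r * (\<Prod>i\<in>UNIV. of_real (jet a x i) ^ b i) *
     of_real (tan (x$2)) ^ h * of_real (cot (x$2)) ^ k * of_real (1 / quad a x \<xi>) ^ l)"

text \<open>A normal form as sums of monomials, generated inductively so that no index sets have to
  be carried. The parities are those of the exponents of the odd generators.\<close>

inductive spanned :: "bool \<Rightarrow> bool \<Rightarrow> family \<Rightarrow> bool" for \<epsilon> \<delta> where
  mono: "\<epsilon> = odd (j + e 1 + e 2) \<Longrightarrow> \<delta> = odd (e 2 + e 3 + h + k) \<Longrightarrow>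
    spanned \<epsilon> \<delta> (monomial_family c j e p r b h k l)"
| add: "spanned \<epsilon> \<delta> g \<Longrightarrow> spanned \<epsilon> \<delta> g' \<Longrightarrow> spanned \<epsilon> \<delta> (\<lambda>a x \<xi>. g a x \<xi> + g' a x \<xi>)"
| cong: "spanned \<epsilon> \<delta> g \<Longrightarrow> (\<And>a x \<xi>. regular_point a x \<xi> \<Longrightarrow> g' a x \<xi> = g a x \<xi>) \<Longrightarrow> spanned \<epsilon> \<delta> g'"

lemma monomial_family_mult:
  "monomial_family c j e p r b h k l a x \<xi> * monomial_family c' j' e' p' r' b' h' k' l' a x \<xi> =
   monomial_family (c * c') (j + j') (\<lambda>i. e i + e' i) (p + p') (r + r') (\<lambda>i. b i + b' i) (h + h') (k + k') (l + l') a x \<xi>"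
  unfolding monomial_family_def by (simp only: of_rat_mult power_add prod.distrib mult_ac)

lemma spanned_mult:
  assumes "spanned \<epsilon> \<delta> g" "spanned \<epsilon>' \<delta>' g'"
  shows "spanned (\<epsilon> \<noteq> \<epsilon>') (\<delta> \<noteq> \<delta>') (\<lambda>a x \<xi>. g a x \<xi> * g' a x \<xi>)"
  using assms(1)
proof induction
  case (mono j e h k c p r b l)
  show ?case using assms(2)
  proof induction
    case (mono j' e' h' k' c' p' r' b' l')
    note hyps = \<open>\<epsilon> = _\<close> \<open>\<delta> = _\<close> mono
    show ?case unfolding monomial_family_mult
      by (rule spanned.mono) (unfold hyps even_add, blast+)
  next
    case (add g g')
    from spanned.add[OF add.IH] show ?case by (simp only: distrib_left)
  next
    case (cong g g')
    show ?case by (rule spanned.cong[OF cong.IH]) (simp add: cong.hyps(2))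
  qed
next
  case (add g g')
  from spanned.add[OF add.IH] show ?case by (simp only: distrib_right)
next
  case (cong g g')
  show ?case by (rule spanned.cong[OF cong.IH]) (simp add: cong.hyps(2))
qed

lemma prod_power_delta:
  "(\<Prod>i\<in>(UNIV::'a::finite set). f i ^ (if i = j then 1 else 0)) = (f j :: 'b::comm_semiring_1)"
proof -
  have "(\<Prod>i\<in>(UNIV::'a set). f i ^ (if i = j then 1 else 0)) = (\<Prod>i\<in>(UNIV::'a set). if i = j then f i else 1)"
    by (rule prod.cong) auto
  then show ?thesis by simp
qed

lemma spanned_u:
  "spanned (i = 1 \<or> i = 2) (i = 2 \<or> i = 3) (\<lambda>a x \<xi>. of_real (hopf_u x \<xi> i))"
proof -
  have "spanned (i = 1 \<or> i = 2) (i = 2 \<or> i = 3) (monomial_family 1 0 (\<lambda>j. if j = i then 1 else 0) 0 0 (\<lambda>_. 0) 0 0 0)"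
    by (rule spanned.mono) auto
  then show ?thesis by (simp add: monomial_family_def prod_power_delta)
qed

lemma spanned_jet: "spanned False False (\<lambda>a x \<xi>. of_real (jet a x i))"
proof -
  have "spanned False False (monomial_family 1 0 (\<lambda>_. 0) 0 0 (\<lambda>j. if j = i then 1 else 0) 0 0 0)"
    by (rule spanned.mono) auto
  then show ?thesis by (simp add: monomial_family_def prod_power_delta)
qed

lemma spanned_generators:
  "spanned False False (\<lambda>a x \<xi>. of_rat c)"
  "spanned True False (\<lambda>a x \<xi>. \<i>)"
  "spanned False False (\<lambda>a x \<xi>. of_real (a (x$1)))"
  "spanned False False (\<lambda>a x \<xi>. of_real (1 / a (x$1)))"
  "spanned False True (\<lambda>a x \<xi>. of_real (tan (x$2)))"
  "spanned False True (\<lambda>a x \<xi>. of_real (cot (x$2)))"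
  "spanned False False (\<lambda>a x \<xi>. of_real (1 / quad a x \<xi>))"
  using spanned.mono[of False 0 "\<lambda>_. 0" False 0 0 c 0 0 "\<lambda>_. 0" 0]
    spanned.mono[of True 1 "\<lambda>_. 0" False 0 0 1 0 0 "\<lambda>_. 0" 0]
    spanned.mono[of False 0 "\<lambda>_. 0" False 0 0 1 1 0 "\<lambda>_. 0" 0]
    spanned.mono[of False 0 "\<lambda>_. 0" False 0 0 1 0 1 "\<lambda>_. 0" 0]
    spanned.mono[of False 0 "\<lambda>_. 0" True 1 0 1 0 0 "\<lambda>_. 0" 0]
    spanned.mono[of False 0 "\<lambda>_. 0" True 0 1 1 0 0 "\<lambda>_. 0" 0]
    spanned.mono[of False 0 "\<lambda>_. 0" False 0 0 1 0 0 "\<lambda>_. 0" 1]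
  by (simp_all add: monomial_family_def)

text \<open>The bound 4 ensures that every derivative of a is a itself or an entry of
  \<open>jet\<close>.\<close>

lemma graded_imp_spanned:
  assumes "graded n \<epsilon> \<delta> g" "n \<le> 4"
  shows "spanned \<epsilon> \<delta> g"
  using assms
proof induction
  case u1 then show ?case using spanned_u[of 1] by (simp add: hopf_u_def)
next
  case u2 then show ?case using spanned_u[of 2] by (simp add: hopf_u_def)
next
  case u3 then show ?case using spanned_u[of 3] by (simp add: hopf_u_def)
next
  case u4 then show ?case using spanned_u[of 4] by (simp add: hopf_u_def)
next
  case u5 then show ?case using spanned_u[of 5] by (simp add: hopf_u_def)
next
  case u6 then show ?case using spanned_u[of 6] by (simp add: hopf_u_def)
next
  case (alpha i)
  then consider "i = 0" | "i = 1" | "i = 2" | "i = 3" | "i = 4" by linarith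
  then show ?case
    by cases (use spanned_generators(3) spanned_jet[of 1] spanned_jet[of 2] spanned_jet[of 3] spanned_jet[of 4]
        in \<open>simp_all add: jet_def\<close>)
next
  case (add \<epsilon> \<delta> g h)
  then show ?case by (intro spanned.add) simp_all
next
  case (mult \<epsilon> \<delta> g \<epsilon>' \<delta>' h)
  from spanned_mult[OF mult.IH] mult show ?case by simp
next
  case (cong \<epsilon> \<delta> g h)
  show ?case by (rule spanned.cong) (use cong in auto)
qed (rule spanned_generators)+

lemma flip_eq_0_iff: "flip j \<xi> = 0 \<longleftrightarrow> \<xi> = 0"
  by (auto simp: flip_def vec_eq_iff)

lemma even_part_add: "even_part (\<lambda>\<xi>. F \<xi> + G \<xi>) = (\<lambda>\<xi>. even_part F \<xi> + even_part G \<xi>)"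
proof -
  have "even_in j (\<lambda>\<xi>. F \<xi> + G \<xi>) = (\<lambda>\<xi>. even_in j F \<xi> + even_in j G \<xi>)" for j F G
    by (simp add: fun_eq_iff even_in_def add_divide_distrib)
  then show ?thesis by (simp add: even_part_def)
qed

text \<open>Sign changes preserve \<open>\<xi> \<noteq> 0\<close>, so values at the origin never
  enter.\<close>

lemma even_part_cong:
  assumes "\<And>\<xi>. \<xi> \<noteq> 0 \<Longrightarrow> F \<xi> = G \<xi>" "\<xi> \<noteq> 0"
  shows "even_part F \<xi> = even_part G \<xi>"
proof -
  have "foldr even_in js F \<zeta> = foldr even_in js G \<zeta>" if "\<zeta> \<noteq> 0" for js \<zeta>
    using that
  proof (induction js arbitrary: \<zeta>)
    case (Cons j js)
    then show ?case by (simp add: even_in_def flip_eq_0_iff)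
  qed (simp add: assms(1))
  with assms(2) show ?thesis unfolding even_part_def by blast
qed

section \<open>Rational functions of the required shape\<close>

lemma is_rw_coefficient_add:
  assumes "is_rw_coefficient f" "is_rw_coefficient g"
  shows "is_rw_coefficient (\<lambda>z. f z + g z)"
proof -
  from assms(1) obtain n c P r k m l where f: "\<forall>u \<alpha> \<alpha>s. \<alpha> \<noteq> 0 \<and> u \<notin> H0 \<union> H1 \<union> CZ \<alpha> \<longrightarrow>
       f (u, \<alpha>, \<alpha>s) = (\<Sum>i<n::nat. of_rat (c i) * (qeval (rw_coord (u, \<alpha>, \<alpha>s)) (P i) /
           (\<alpha> ^ (2 * r i) * (u$0) ^ k i * (1 - u$0) ^ m i * Q4 \<alpha> u ^ l i)))"
    unfolding is_rw_coefficient_def by blast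
  from assms(2) obtain n' c' P' r' k' m' l' where g: "\<forall>u \<alpha> \<alpha>s. \<alpha> \<noteq> 0 \<and> u \<notin> H0 \<union> H1 \<union> CZ \<alpha> \<longrightarrow>
       g (u, \<alpha>, \<alpha>s) = (\<Sum>i<n'::nat. of_rat (c' i) * (qeval (rw_coord (u, \<alpha>, \<alpha>s)) (P' i) /
           (\<alpha> ^ (2 * r' i) * (u$0) ^ k' i * (1 - u$0) ^ m' i * Q4 \<alpha> u ^ l' i)))"
    unfolding is_rw_coefficient_def by blast
  \<comment> \<open>The two families of terms are concatenated; indices from \<open>n\<close> on
    belong to \<open>g\<close>.\<close>
  have split: "(\<Sum>i<n + n'. h i) = (\<Sum>i<n. h i) + (\<Sum>i<n'. h (n + i))" for h :: "nat \<Rightarrow> complex"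
    by (induction n') simp_all
  show ?thesis
    unfolding is_rw_coefficient_def
  proof (rule exI[of _ "n + n'"],
        rule exI[of _ "\<lambda>i. if i < n then c i else c' (i - n)"],
        rule exI[of _ "\<lambda>i. if i < n then P i else P' (i - n)"],
        rule exI[of _ "\<lambda>i. if i < n then r i else r' (i - n)"],
        rule exI[of _ "\<lambda>i. if i < n then k i else k' (i - n)"],
        rule exI[of _ "\<lambda>i. if i < n then m i else m' (i - n)"],
        rule exI[of _ "\<lambda>i. if i < n then l i else l' (i - n)"],
        intro allI impI, goal_cases)
    case (1 u \<alpha> \<alpha>s)
    show ?case
      unfolding split f[rule_format, OF 1] g[rule_format, OF 1]
      by (intro arg_cong2[where f="(+)"] sum.cong) simp_all
  qed
qed

lemma is_rw_coefficient_term: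
  assumes "polynomial_over_Q P"
  shows "is_rw_coefficient (\<lambda>(u, \<alpha>, \<alpha>s). of_rat c * (P (rw_coord (u, \<alpha>, \<alpha>s)) /
     (\<alpha> ^ (2 * r) * (u$0) ^ k * (1 - u$0) ^ m * Q4 \<alpha> u ^ l)))"
proof -
  from assms obtain p where p: "\<And>z. P z = qeval z p" by (auto simp: polynomial_over_Q_def)
  show ?thesis
    unfolding is_rw_coefficient_def
    by (rule exI[of _ 1], rule exI[of _ "\<lambda>_. c"], rule exI[of _ "\<lambda>_. p"], rule exI[of _ "\<lambda>_. r"],
        rule exI[of _ "\<lambda>_. k"], rule exI[of _ "\<lambda>_. m"], rule exI[of _ "\<lambda>_. l"])
       (simp add: p)
qed


lemma is_rw_coefficient_0: "is_rw_coefficient (\<lambda>_. 0)"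
  unfolding is_rw_coefficient_def by (rule exI[of _ 0]) simp

lemma chart_hopf:
  "chart a (x, \<xi>) = (\<chi> i. if i = 0 then of_real ((sin (x$2))\<^sup>2) else
       of_real (if i = 1 then hopf_u x \<xi> 1 else if i = 2 then hopf_u x \<xi> 2 else if i = 3 then hopf_u x \<xi> 3
         else if i = 4 then hopf_u x \<xi> 4 else if i = 5 then hopf_u x \<xi> 5 else hopf_u x \<xi> 6),
     of_real (a (x$1)), \<chi> i. of_real (jet a x i))"
  by (auto simp: chart_def hopf_u_def jet_def vec_eq_iff)

lemma chart_Q4:
  "Q4 (of_real (a (x$1))) (fst (chart a (x, \<xi>))) = of_real (quad a x \<xi>)"
  by (simp add: chart_hopf Q4_def quad_def hopf_u_def)

text \<open>The quotient is (sin cos)^(h+k) over sin^(2k) cos^(2h); for even h + k it is rational in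
  the squared sine.\<close>

lemma tan_cot_power:
  fixes y :: real
  assumes "sin y \<noteq> 0" "cos y \<noteq> 0" "even (h + k)"
  shows "tan y ^ h * cot y ^ k =
    ((sin y)\<^sup>2 * (1 - (sin y)\<^sup>2)) ^ ((h + k) div 2) / (((sin y)\<^sup>2) ^ k * (1 - (sin y)\<^sup>2) ^ h)"
proof -
  have "((sin y)\<^sup>2 * (1 - (sin y)\<^sup>2)) ^ ((h + k) div 2) = (sin y * cos y) ^ (2 * ((h + k) div 2))"
    by (simp add: cos_squared_eq[symmetric] power_mult power_mult_distrib)
  also have "2 * ((h + k) div 2) = h + k"
    using assms(3) by simp
  finally have "((sin y)\<^sup>2 * (1 - (sin y)\<^sup>2)) ^ ((h + k) div 2) = (sin y * cos y) ^ (h + k)" .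
  then show ?thesis
    using assms(1,2) unfolding cos_squared_eq[symmetric] unfolding power2_eq_square tan_def cot_def
    by (simp add: power_add power_mult_distrib power_divide)
qed

lemma prod_6: "prod f (UNIV :: 6 set) = f 1 * f 2 * f 3 * f 4 * f 5 * f 6"
  unfolding UNIV_6 by (simp add: mult.assoc)

text \<open>Parity does the work here: \<open>\<i>\<close> and \<open>tan \<eta>\<close> occur with even exponents once all the \<open>\<xi>\<^sub>j\<close> do.\<close>

lemma even_part_monomial_family:
  assumes "even (j + e 1 + e 2)" "even (e 2 + e 3 + h + k)"
  shows "\<exists>f. is_rw_coefficient f \<and> (\<forall>a x \<xi>. regular_point a x \<xi> \<longrightarrow>
    even_part (monomial_family c j e p r b h k l a x) \<xi> = f (chart a (x, \<xi>)))"
proof -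
  \<comment> \<open>Everything independent of \<xi> is collected here, including csc and sec from
    u_3 and u_4, to reach the shape of \<open>even_part_term\<close>.\<close>
  define C where "C a x = of_rat c * \<i> ^ j * of_real ((1 / sin (x$2)) ^ e 3 * (1 / cos (x$2)) ^ e 4) *
     of_real (a (x$1)) ^ p * of_real (1 / a (x$1)) ^ r * (\<Prod>i\<in>UNIV. of_real (jet a x i) ^ b i) *
     of_real (tan (x$2)) ^ h * of_real (cot (x$2)) ^ k" for a and x :: "real^4"
  have U: "(\<Prod>i\<in>UNIV. complex_of_real (hopf_u x \<xi> i) ^ e i) =
      of_real ((1 / sin (x$2)) ^ e 3 * (1 / cos (x$2)) ^ e 4) * (\<Prod>i\<in>UNIV. of_real (\<xi>$i) ^ e i)" for x \<xi>
    by (simp add: prod_6 hopf_u_def power_divide)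
  have m: "monomial_family c j e p r b h k l a x =
      (\<lambda>\<xi>. C a x * (\<Prod>i\<in>UNIV. of_real (\<xi>$i) ^ e i) * of_real (1 / quad a x \<xi>) ^ l)" for a x
    by (simp only: fun_eq_iff monomial_family_def C_def U mult_ac) simp
  have q: "of_real (1 / quad a x (flip i \<xi>)) ^ l = (of_real (1 / quad a x \<xi>) :: complex) ^ l" for a x i \<xi>
    by (simp add: quad_def flip_def power_divide)
  note ep = even_part_term[where G="\<lambda>\<xi>. of_real (1 / quad a x \<xi>) ^ l" and c="C a x" and e=e for a x, OF q, folded m]
  show ?thesis
  proof (cases "\<forall>i\<in>{1, 2, 3, 4, 5, 6}. even (e i)")
    case False
    then show ?thesis
      by (intro exI[of _ "\<lambda>_. 0"]) (auto simp: ep is_rw_coefficient_0)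
  next
    case True
    then have ev: "even j" "even (h + k)" using assms by auto
    define P where "P z = z (VarU 1) ^ e 1 * z (VarU 2) ^ e 2 * z (VarU 3) ^ e 3 * z (VarU 4) ^ e 4 *
        z (VarU 5) ^ e 5 * z (VarU 6) ^ e 6 * z VarAlpha ^ (p + r) * (\<Prod>i\<in>UNIV. z (VarAlphaD i) ^ b i) *
        (z (VarU 0) * (1 - z (VarU 0))) ^ ((h + k) div 2)" for z :: "rw_var \<Rightarrow> complex"
    have P: "polynomial_over_Q P"
      unfolding P_def by (intro polynomial_over_Q_intros)
    let ?f = "\<lambda>(u, \<alpha>, \<alpha>s). of_rat (c * (-1) ^ (j div 2)) * (P (rw_coord (u, \<alpha>, \<alpha>s)) /
        (\<alpha> ^ (2 * r) * (u$0) ^ k * (1 - u$0) ^ h * Q4 \<alpha> u ^ l))"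
    have "even_part (monomial_family c j e p r b h k l a x) \<xi> = ?f (chart a (x, \<xi>))"
      if reg: "regular_point a x \<xi>" for a x \<xi>
    proof -
      note f = regular_point_facts(1-3)[OF reg] quad_pos[OF reg]
      define s where "s = (complex_of_real (sin (x$2)))\<^sup>2"
      have I: "\<i> ^ j = of_rat ((-1) ^ (j div 2))"
        using ev(1) by (auto elim!: evenE simp: power_mult of_rat_power)
      \<comment> \<open>The required denominators contain only even powers of \<alpha>, so numerator
        and denominator are multiplied by \<alpha>^r.\<close>
      have A: "complex_of_real (a (x$1)) ^ p * of_real (1 / a (x$1)) ^ r =
          of_real (a (x$1)) ^ (p + r) / of_real (a (x$1)) ^ (2 * r)"
        using f(1) by (simp add: power_add power_divide mult_2)
      have T: "complex_of_real (tan (x$2)) ^ h * of_real (cot (x$2)) ^ k =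
          (s * (1 - s)) ^ ((h + k) div 2) / (s ^ k * (1 - s) ^ h)"
        using arg_cong[OF tan_cot_power[of "x$2" h k], of complex_of_real] f(2,3) ev(2)
        by (simp add: s_def)
      have c: "fst (chart a (x, \<xi>)) $ 0 = s" "fst (chart a (x, \<xi>)) $ 1 = of_real (hopf_u x \<xi> 1)"
          "fst (chart a (x, \<xi>)) $ 2 = of_real (hopf_u x \<xi> 2)" "fst (chart a (x, \<xi>)) $ 3 = of_real (hopf_u x \<xi> 3)"
          "fst (chart a (x, \<xi>)) $ 4 = of_real (hopf_u x \<xi> 4)" "fst (chart a (x, \<xi>)) $ 5 = of_real (hopf_u x \<xi> 5)"
          "fst (chart a (x, \<xi>)) $ 6 = of_real (hopf_u x \<xi> 6)"
        by (simp_all add: chart_hopf s_def)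
      obtain u where u: "chart a (x, \<xi>) = (u, of_real (a (x$1)), \<chi> i. of_real (jet a x i))"
        by (simp add: chart_hopf)
      have Q: "Q4 (of_real (a (x$1))) u = of_real (quad a x \<xi>)"
        using chart_Q4[of a x \<xi>] by (simp add: u)
      have "even_part (monomial_family c j e p r b h k l a x) \<xi> = monomial_family c j e p r b h k l a x \<xi>"
        using True by (simp add: ep)
      also have "\<dots> = of_rat c * \<i> ^ j * (\<Prod>i\<in>UNIV. of_real (hopf_u x \<xi> i) ^ e i) *
          (of_real (a (x$1)) ^ p * of_real (1 / a (x$1)) ^ r) * (\<Prod>i\<in>UNIV. of_real (jet a x i) ^ b i) *
          (of_real (tan (x$2)) ^ h * of_real (cot (x$2)) ^ k) * of_real (1 / quad a x \<xi>) ^ l"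
        by (simp only: monomial_family_def mult.assoc)
      also have "\<dots> = ?f (chart a (x, \<xi>))"
        unfolding I A T using c unfolding u
        by (simp add: P_def Q of_rat_mult prod_6 power_divide mult.assoc)
      finally show ?thesis .
    qed
    then show ?thesis
      using is_rw_coefficient_term[OF P] by blast
  qed
qed

text \<open>\<open>f\<close> is chosen before \<open>a\<close>: one rational function serves all
  scale factors.\<close>

lemma even_part_spanned:
  assumes "spanned False False g"
  shows "\<exists>f. is_rw_coefficient f \<and> (\<forall>a x \<xi>. regular_point a x \<xi> \<longrightarrow> even_part (g a x) \<xi> = f (chart a (x, \<xi>)))"
  using assms
proof induction
  case (mono j e h k c p r b l)
  then show ?case by (intro even_part_monomial_family) simp_all
next
  case (add g g')
  then obtain f f' where "is_rw_coefficient f" "is_rw_coefficient f'"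
    "\<forall>a x \<xi>. regular_point a x \<xi> \<longrightarrow> even_part (g a x) \<xi> = f (chart a (x, \<xi>))"
    "\<forall>a x \<xi>. regular_point a x \<xi> \<longrightarrow> even_part (g' a x) \<xi> = f' (chart a (x, \<xi>))" by blast
  then show ?case
    by (intro exI[of _ "\<lambda>z. f z + f' z"]) (simp add: is_rw_coefficient_add even_part_add)
next
  case (cong g g')
  \<comment> \<open>Once a regular point with this \<open>a\<close> and \<open>x\<close> is given,
    every other nonzero \<xi> gives a regular point too.\<close>
  have "even_part (g' a x) \<xi> = even_part (g a x) \<xi>" if "regular_point a x \<xi>" for a x \<xi>
    by (rule even_part_cong) (use that cong.hyps(2) in \<open>auto simp: regular_point_def\<close>)
  with cong.IH show ?case by simp
qed

text \<open>For N = 4 the order bound is 4, which accounts for the four variables \<alpha>_1 to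
  \<alpha>_4.\<close>

lemma b6_rw_coefficient:
  "\<exists>f. is_rw_coefficient f \<and> (\<forall>a x \<xi>. regular_point a x \<xi> \<longrightarrow> b6 a x \<xi> = f (chart a (x, \<xi>)))"
  unfolding b6_def
  by (intro even_part_spanned graded_imp_spanned[of 4] graded_trace graded_sigma) simp

section \<open>The change of variables\<close>

lemma wedge_compose: "wedge \<theta>s (\<lambda>i. F (v i)) = wedge (map (\<lambda>\<theta> w. \<theta> (F w)) \<theta>s) v"
  unfolding wedge_def by simp

text \<open>The coefficient of d\<xi>_i in the pullback of du_i; \<open>hopf_shear\<close> is that
  of d\<eta>.\<close>

definition hopf_scale :: "real^4 \<Rightarrow> nat \<Rightarrow> real" where
  "hopf_scale x i = (if i = 3 then 1 / sin (x$2) else if i = 4 then 1 / cos (x$2) else 1)"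

definition hopf_shear :: "real^4 \<Rightarrow> real^6 \<Rightarrow> nat \<Rightarrow> real" where
  "hopf_shear x \<xi> i = (if i = 3 then - (\<xi>$3 * cos (x$2) / (sin (x$2))\<^sup>2)
     else if i = 4 then \<xi>$4 * sin (x$2) / (cos (x$2))\<^sup>2 else 0)"

text \<open>The whole chart, jets included, must be differentiable for
  \<open>frechet_derivative\<close> to be determined. Only the u-components are recorded, which are
  the ones \<open>sigma5_tilde\<close> reads.\<close>

lemma chart_has_derivative:
  assumes reg: "regular_point a x \<xi>"
  obtains D where "(chart a has_derivative D) (at (x, \<xi>))"
    "\<And>w. fst (D w) $ 0 = of_real (2 * sin (x$2) * cos (x$2)) * of_real (fst w $ 2)"
    "\<And>w i. i \<in> {1..<7} \<Longrightarrow> fst (D w) $ of_nat i =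
       of_real (hopf_scale x i) * of_real (snd w $ of_nat i) + of_real (hopf_shear x \<xi> i) * of_real (fst w $ 2)"
proof -
  note f = regular_point_facts[OF reg]
  define DU :: "(real^4) \<times> (real^6) \<Rightarrow> 7 \<Rightarrow> real" where "DU w i = (if i = 0 then 2 * sin (x$2) * cos (x$2) * fst w $ 2
     else if i = 1 then snd w $ 1 else if i = 2 then snd w $ 2
     else if i = 3 then 1 / sin (x$2) * snd w $ 3 - (\<xi>$3 * cos (x$2) / (sin (x$2))\<^sup>2) * fst w $ 2
     else if i = 4 then 1 / cos (x$2) * snd w $ 4 + (\<xi>$4 * sin (x$2) / (cos (x$2))\<^sup>2) * fst w $ 2
     else if i = 5 then snd w $ 5 else snd w $ 6)" for w i
  \<comment> \<open>The fifth derivative of a appears because the fourth is itself a coordinate of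
    the chart.\<close>
  define DJ :: "(real^4) \<times> (real^6) \<Rightarrow> 4 \<Rightarrow> real" where "DJ w i = fst w $ 1 * (if i = 1 then (deriv ^^ 2) a (x$1)
     else if i = 2 then (deriv ^^ 3) a (x$1) else if i = 3 then (deriv ^^ 4) a (x$1) else (deriv ^^ 5) a (x$1))" for w i
  define D :: "(real^4) \<times> (real^6) \<Rightarrow> rw_point" where
    "D w = (\<chi> i. of_real (DU w i), of_real (fst w $ 1 * deriv a (x$1)), \<chi> i. of_real (DJ w i))" for w
  have d1 [derivative_intros]: "((\<lambda>p. fst p $ i) has_derivative (\<lambda>w. fst w $ i)) (at p)" for i and p :: "(real^4) \<times> (real^6)"
    by (intro bounded_linear_imp_has_derivative bounded_linear_compose[OF bounded_linear_vec_nth bounded_linear_fst])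
  have d2 [derivative_intros]: "((\<lambda>p. snd p $ i) has_derivative (\<lambda>w. snd w $ i)) (at p)" for i and p :: "(real^4) \<times> (real^6)"
    by (intro bounded_linear_imp_has_derivative bounded_linear_compose[OF bounded_linear_vec_nth bounded_linear_snd])
  have dJ: "((\<lambda>p. (deriv ^^ i) a (fst p $ 1)) has_derivative (\<lambda>w. fst w $ 1 * (deriv ^^ Suc i) a (x$1))) (at (x, \<xi>))" for i
    by (rule DERIV_compose_FDERIV[OF _ d1]) (use f(4) in simp)
  have U: "((\<lambda>p. if i = 0 then (sin (fst p$2))\<^sup>2
         else if i = 1 then snd p$1
         else if i = 2 then snd p$2
         else if i = 3 then snd p$3 / sin (fst p$2)
         else if i = 4 then snd p$4 / cos (fst p$2)
         else if i = 5 then snd p$5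
         else snd p$6) has_derivative (\<lambda>w. DU w i)) (at (x, \<xi>))" for i :: 7
  proof -
    have 3: "((\<lambda>p. snd p$3 / sin (fst p$2)) has_derivative (\<lambda>w. DU w 3)) (at (x, \<xi>))"
      using f(2) by (auto intro!: derivative_eq_intros simp: DU_def fun_eq_iff field_simps power2_eq_square)
    have 4: "((\<lambda>p. snd p$4 / cos (fst p$2)) has_derivative (\<lambda>w. DU w 4)) (at (x, \<xi>))"
      using f(3) by (auto intro!: derivative_eq_intros simp: DU_def fun_eq_iff field_simps power2_eq_square)
    have 0: "((\<lambda>p. (sin (fst p$2))\<^sup>2) has_derivative (\<lambda>w. DU w 0)) (at (x, \<xi>))"
      by (auto intro!: derivative_eq_intros simp: DU_def fun_eq_iff)
    show ?thesis
      using 0 3 4 d2 by (cases "i = 0"; cases "i = 1"; cases "i = 2"; cases "i = 3"; cases "i = 4"; cases "i = 5")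
        (simp_all add: DU_def)
  qed
  have J: "((\<lambda>p. if i = 1 then deriv a (fst p$1)
         else if i = 2 then (deriv ^^ 2) a (fst p$1)
         else if i = 3 then (deriv ^^ 3) a (fst p$1)
         else (deriv ^^ 4) a (fst p$1)) has_derivative (\<lambda>w. DJ w i)) (at (x, \<xi>))" for i :: 4
    using dJ[of 1] dJ[of 2] dJ[of 3] dJ[of 4]
    by (cases "i = 1"; cases "i = 2"; cases "i = 3") (simp_all add: DJ_def eval_nat_numeral)
  have "(chart a has_derivative D) (at (x, \<xi>))"
    unfolding chart_def case_prod_beta D_def[abs_def]
    by (intro has_derivative_Pair has_derivative_vec, unfold vec_lambda_beta)
       (rule bounded_linear.has_derivative[OF bounded_linear_of_real U]
          bounded_linear.has_derivative[OF bounded_linear_of_real J]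
          bounded_linear.has_derivative[OF bounded_linear_of_real dJ[of 0, simplified]])+
  moreover have "fst (D w) $ 0 = of_real (2 * sin (x$2) * cos (x$2)) * of_real (fst w $ 2)" for w
    by (simp add: D_def DU_def)
  moreover have "fst (D w) $ of_nat i =
       of_real (hopf_scale x i) * of_real (snd w $ of_nat i) + of_real (hopf_shear x \<xi> i) * of_real (fst w $ 2)"
    if "i \<in> {1..<7}" for w i
  proof -
    from that consider "i = 1" | "i = 2" | "i = 3" | "i = 4" | "i = 5" | "i = 6" by force
    then show ?thesis
      by cases (simp_all add: D_def DU_def hopf_scale_def hopf_shear_def)
  qed
  ultimately show thesis by (rule that)
qed

lemma prod_list_map_remove1:
  fixes f :: "'a \<Rightarrow> 'b::comm_monoid_mult"
  shows "x \<in> set xs \<Longrightarrow> f x * prod_list (map f (remove1 x xs)) = prod_list (map f xs)"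
  by (induction xs) (auto simp: mult.left_commute)

text \<open>The coefficient u_j supplies the scale missing from the j-th wedge, so each summand
  carries the same full product of scales. The 2 in du_0 cancels the 1/2 in
  \<open>sigma5_tilde\<close>.\<close>

lemma pullback_sigma5_tilde:
  assumes reg: "regular_point a x \<xi>"
  shows "sigma5_tilde (chart a (x, \<xi>)) (\<lambda>i. frechet_derivative (chart a) (at (x, \<xi>)) (v i)) = deta_sigma5 (x, \<xi>) v"
proof -
  note f = regular_point_facts(1-3)[OF reg]
  obtain D where D: "(chart a has_derivative D) (at (x, \<xi>))"
    and D0: "\<And>w. fst (D w) $ 0 = of_real (2 * sin (x$2) * cos (x$2)) * of_real (fst w $ 2)"
    and Di: "\<And>w i. i \<in> {1..<7} \<Longrightarrow> fst (D w) $ of_nat i =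
       of_real (hopf_scale x i) * of_real (snd w $ of_nat i) + of_real (hopf_shear x \<xi> i) * of_real (fst w $ 2)"
    using chart_has_derivative[OF reg] by blast
  let ?r = "\<lambda>i. complex_of_real (hopf_scale x i)" and ?sc = "complex_of_real (sin (x$2) * cos (x$2))"
  let ?W = "\<lambda>j. wedge ((\<lambda>w. of_real (fst w $ 2)) # map (\<lambda>i w. of_real (snd w $ of_nat i)) (remove1 j [1..<7])) v"
  \<comment> \<open>The scales multiply to csc \<eta> sec \<eta>.\<close>
  have P: "prod_list (map ?r [1..<7]) * ?sc = 1"
    using f(2,3) by (simp add: hopf_scale_def upt_rec numeral_eq_Suc)
  have "fst (chart a (x, \<xi>)) $ of_nat j *
      wedge (map (\<lambda>i w. fst w $ of_nat i) (remove1 j [0..<7])) (\<lambda>i. D (v i)) = 2 * (of_real (\<xi> $ of_nat j) * ?W j)"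
    if j: "j \<in> {1..6}" for j
  proof -
    have u: "fst (chart a (x, \<xi>)) $ of_nat j = ?r j * of_real (\<xi> $ of_nat j)"
    proof -
      from j consider "j = 1" | "j = 2" | "j = 3" | "j = 4" | "j = 5" | "j = 6" by force
      then show ?thesis by cases (simp_all add: chart_def hopf_scale_def)
    qed
    have up: "[0..<7] = 0 # [1..<7]" by (simp add: upt_conv_Cons)
    have rm: "remove1 j [0..<7] = 0 # remove1 j [1..<7]"
      unfolding up using j by simp
    have "wedge (map (\<lambda>i w. fst w $ of_nat i) (remove1 j [0..<7])) (\<lambda>i. D (v i)) =
        wedge ((\<lambda>w. fst (D w) $ 0) # map (\<lambda>i w. fst (D w) $ of_nat i) (remove1 j [1..<7])) v"
      unfolding wedge_compose rm by (simp add: comp_def)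
    also have "map (\<lambda>i w. fst (D w) $ of_nat i) (remove1 j [1..<7]) =
        map (\<lambda>i w. ?r i * of_real (snd w $ of_nat i) + of_real (hopf_shear x \<xi> i) * of_real (fst w $ 2)) (remove1 j [1..<7])"
      by (rule map_cong[OF refl]) (use set_remove1_subset[of j "[1..<7]"] Di in \<open>auto simp: fun_eq_iff\<close>)
    also have "wedge ((\<lambda>w. fst (D w) $ 0) # \<dots>) v =
        of_real (2 * sin (x$2) * cos (x$2)) * prod_list (map ?r (remove1 j [1..<7])) * ?W j"
      unfolding D0 by (rule wedge_triangular)
    finally have "fst (chart a (x, \<xi>)) $ of_nat j *
      wedge (map (\<lambda>i w. fst w $ of_nat i) (remove1 j [0..<7])) (\<lambda>i. D (v i)) =
      2 * ((?r j * prod_list (map ?r (remove1 j [1..<7]))) * ?sc) * (of_real (\<xi> $ of_nat j) * ?W j)"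
      by (simp add: u)
    also have "?r j * prod_list (map ?r (remove1 j [1..<7])) = prod_list (map ?r [1..<7])"
      by (rule prod_list_map_remove1) (use j in auto)
    finally show ?thesis unfolding P by simp
  qed
  then show ?thesis
    unfolding sigma5_tilde_def deta_sigma5_def frechet_derivative_at[OF D, symmetric] sum_distrib_left
    by (intro sum.cong refl) (simp add: mult.assoc del: upt_Suc)
qed

section \<open>Regularity on the slices\<close>

text \<open>A global fraction instead of local ones as in \<open>regular_over_Q\<close>; in this
  form closure under sums and products is immediate.\<close>

definition fraction_over_Q :: "(complex^'n) set \<Rightarrow> (complex^'n \<Rightarrow> complex) \<Rightarrow> bool" where
  "fraction_over_Q U g \<longleftrightarrow> (\<exists>N G. polynomial_over_Q N \<and> polynomial_over_Q G \<and>
     (\<forall>u\<in>U. G (($) u) \<noteq> 0 \<and> g u = N (($) u) / G (($) u)))"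

lemma fraction_over_Q_imp_regular:
  assumes "fraction_over_Q U g"
  shows "regular_over_Q U g"
proof -
  from assms obtain N G where "\<forall>u\<in>U. qeval (($) u) G \<noteq> 0 \<and> g u = qeval (($) u) N / qeval (($) u) G"
    unfolding fraction_over_Q_def polynomial_over_Q_def by metis
  then show ?thesis unfolding regular_over_Q_def by blast
qed

lemma fraction_over_Q_divide:
  assumes "polynomial_over_Q N" "polynomial_over_Q G" "\<And>u. u \<in> U \<Longrightarrow> G (($) u) \<noteq> 0"
  shows "fraction_over_Q U (\<lambda>u. N (($) u) / G (($) u))"
  unfolding fraction_over_Q_def using assms by blast

lemma fraction_over_Q_poly:
  "polynomial_over_Q N \<Longrightarrow> fraction_over_Q U (\<lambda>u. N (($) u))"
  using fraction_over_Q_divide[of N "\<lambda>_. 1" U] by (simp add: polynomial_over_Q_consts)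

lemma fraction_over_Q_cong:
  "fraction_over_Q U g \<Longrightarrow> (\<And>u. u \<in> U \<Longrightarrow> h u = g u) \<Longrightarrow> fraction_over_Q U h"
  unfolding fraction_over_Q_def by simp

lemma fraction_over_Q_add:
  assumes "fraction_over_Q U g" "fraction_over_Q U h"
  shows "fraction_over_Q U (\<lambda>u. g u + h u)"
proof -
  obtain N G N' G' where "polynomial_over_Q N" "polynomial_over_Q G" "polynomial_over_Q N'" "polynomial_over_Q G'"
    and eq: "\<forall>u\<in>U. G (($) u) \<noteq> 0 \<and> g u = N (($) u) / G (($) u)" "\<forall>u\<in>U. G' (($) u) \<noteq> 0 \<and> h u = N' (($) u) / G' (($) u)"
    using assms unfolding fraction_over_Q_def by blast
  then have "fraction_over_Q U (\<lambda>u. (\<lambda>z. N z * G' z + N' z * G z) (($) u) / (\<lambda>z. G z * G' z) (($) u))"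
    by (intro fraction_over_Q_divide polynomial_over_Q_intros) auto
  then show ?thesis
    by (rule fraction_over_Q_cong) (use eq in \<open>simp add: add_frac_eq\<close>)
qed

lemma fraction_over_Q_mult:
  assumes "fraction_over_Q U g" "fraction_over_Q U h"
  shows "fraction_over_Q U (\<lambda>u. g u * h u)"
proof -
  obtain N G N' G' where "polynomial_over_Q N" "polynomial_over_Q G" "polynomial_over_Q N'" "polynomial_over_Q G'"
    and eq: "\<forall>u\<in>U. G (($) u) \<noteq> 0 \<and> g u = N (($) u) / G (($) u)" "\<forall>u\<in>U. G' (($) u) \<noteq> 0 \<and> h u = N' (($) u) / G' (($) u)"
    using assms unfolding fraction_over_Q_def by blast
  then have "fraction_over_Q U (\<lambda>u. (\<lambda>z. N z * N' z) (($) u) / (\<lambda>z. G z * G' z) (($) u))"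
    by (intro fraction_over_Q_divide polynomial_over_Q_intros) auto
  then show ?thesis
    by (rule fraction_over_Q_cong) (use eq in simp)
qed

lemma fraction_over_Q_sum:
  "(\<And>i. i \<in> A \<Longrightarrow> fraction_over_Q U (g i)) \<Longrightarrow> fraction_over_Q U (\<lambda>u. \<Sum>i\<in>A. g i u)"
  by (induction A rule: infinite_finite_induct)
     (auto intro: fraction_over_Q_add fraction_over_Q_poly[OF polynomial_over_Q_consts(1)])

text \<open>For fixed rational \<alpha> the factor \<alpha>^(-2) is a rational coefficient, so the
  quadratic form is a polynomial in u.\<close>

definition quad_poly :: "rat \<Rightarrow> (7 \<Rightarrow> complex) \<Rightarrow> complex" where
  "quad_poly \<alpha> z = (z 1)\<^sup>2 + of_rat (1 / \<alpha>\<^sup>2) * ((z 2)\<^sup>2 + (z 3)\<^sup>2 + (z 4)\<^sup>2) + (z 5)\<^sup>2 + (z 6)\<^sup>2"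

lemma polynomial_over_Q_quad_poly: "polynomial_over_Q (quad_poly \<alpha>)"
  unfolding quad_poly_def[abs_def] by (intro polynomial_over_Q_intros)

lemma quad_poly_eq: "quad_poly \<alpha> (($) u) = Q4 (of_rat \<alpha>) u"
  by (simp add: quad_poly_def Q4_def of_rat_divide of_rat_power)

lemma fraction_over_Q_rw_coefficient:
  assumes "is_rw_coefficient f" "\<alpha> \<noteq> 0"
  shows "fraction_over_Q (- (H0 \<union> H1 \<union> CZ (of_rat \<alpha>))) (\<lambda>u. f (slice \<alpha> \<alpha>s u))"
proof -
  let ?U = "- (H0 \<union> H1 \<union> CZ (of_rat \<alpha>))" and ?\<alpha>s = "\<chi> i. of_rat (\<alpha>s $ i)"
  obtain n c P r k m l where f: "\<forall>u \<alpha> \<alpha>s. \<alpha> \<noteq> 0 \<and> u \<notin> H0 \<union> H1 \<union> CZ \<alpha> \<longrightarrow>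
       f (u, \<alpha>, \<alpha>s) = (\<Sum>i<n::nat. of_rat (c i) * (qeval (rw_coord (u, \<alpha>, \<alpha>s)) (P i) /
           (\<alpha> ^ (2 * r i) * (u$0) ^ k i * (1 - u$0) ^ m i * Q4 \<alpha> u ^ l i)))"
    using assms(1) unfolding is_rw_coefficient_def by blast
  have P: "polynomial_over_Q (\<lambda>z. qeval (rw_coord (\<chi> i. z i, of_rat \<alpha>, ?\<alpha>s)) (P i))" for i
  proof (rule polynomial_over_Q_subst)
    fix v show "polynomial_over_Q (\<lambda>z. rw_coord (\<chi> i. z i, of_rat \<alpha>, ?\<alpha>s) v)"
      by (cases v) (auto intro: polynomial_over_Q_intros)
  qed
  \<comment> \<open>No denominator vanishes on \<open>?U\<close>, where u_0, 1 - u_0 and the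
    quadratic form are nonzero; \<alpha> is a nonzero constant.\<close>
  have "fraction_over_Q ?U (\<lambda>u. (\<lambda>z. of_rat (c i) * qeval (rw_coord (\<chi> i. z i, of_rat \<alpha>, ?\<alpha>s)) (P i)) (($) u) /
      (\<lambda>z. of_rat \<alpha> ^ (2 * r i) * z 0 ^ k i * (1 - z 0) ^ m i * quad_poly \<alpha> z ^ l i) (($) u))" for i
    by (intro fraction_over_Q_divide polynomial_over_Q_intros P polynomial_over_Q_quad_poly)
       (use assms(2) in \<open>auto simp: quad_poly_eq H0_def H1_def CZ_def\<close>)
  then have "fraction_over_Q ?U (\<lambda>u. \<Sum>i<n. (\<lambda>z. of_rat (c i) * qeval (rw_coord (\<chi> i. z i, of_rat \<alpha>, ?\<alpha>s)) (P i)) (($) u) /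
      (\<lambda>z. of_rat \<alpha> ^ (2 * r i) * z 0 ^ k i * (1 - z 0) ^ m i * quad_poly \<alpha> z ^ l i) (($) u))"
    by (rule fraction_over_Q_sum)
  then show ?thesis
    by (rule fraction_over_Q_cong) (use assms(2) in \<open>simp add: slice_def f quad_poly_eq\<close>)
qed

text \<open>The union of the three hypersurfaces is the zero set of the product of their
  equations.\<close>

lemma zariski_open_complement:
  assumes "\<alpha> \<noteq> 0"
  shows "zariski_open_over_Q (- (H0 \<union> H1 \<union> CZ (of_rat \<alpha>)))"
proof -
  have "polynomial_over_Q (\<lambda>z. z 0 * (1 - z 0) * quad_poly \<alpha> z)"
    by (intro polynomial_over_Q_intros polynomial_over_Q_quad_poly)
  then obtain P where "\<And>z. z 0 * (1 - z 0) * quad_poly \<alpha> z = qeval z P"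
    by (auto simp: polynomial_over_Q_def)
  then have "- (H0 \<union> H1 \<union> CZ (of_rat \<alpha>)) = {u. \<exists>P\<in>{P}. qeval (($) u) P \<noteq> 0}"
    by (auto simp: H0_def H1_def CZ_def quad_poly_eq simp flip: \<open>\<And>z. _ = qeval z P\<close>)
  then show ?thesis unfolding zariski_open_over_Q_def by blast
qed

lemma algebraic_form_slice:
  assumes "is_rw_coefficient f" "\<alpha> \<noteq> 0"
  shows "algebraic_form_over_Q 6 (- (H0 \<union> H1 \<union> CZ (of_rat \<alpha>))) (pullback (slice \<alpha> \<alpha>s) (Omega f))"
proof -
  let ?U = "- (H0 \<union> H1 \<union> CZ (of_rat \<alpha>))"
  let ?J = "\<lambda>j. map of_nat (remove1 j [0..<7]) :: 7 list"
  define t where "t j u = of_rat (1/2) * ((-1) ^ (j - 1) * u $ of_nat j) * f (slice \<alpha> \<alpha>s u)" for j and u :: "complex^7"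
  \<comment> \<open>Among all index lists only the six lists \<open>?J j\<close> receive a
    coefficient; F collects it by comparing lists.\<close>
  define F where "F I u = (\<Sum>j=1..6. if I = ?J j then t j u else 0)" for I u
  have len: "length (?J j) = 6" if "j \<in> {1..6}" for j
    using that by (simp add: length_remove1)
  have "fraction_over_Q ?U (t j)" for j
    unfolding t_def[abs_def]
    by (intro fraction_over_Q_mult fraction_over_Q_rw_coefficient[OF assms]
          fraction_over_Q_poly[of "\<lambda>z. of_rat (1/2)"] fraction_over_Q_poly[of "\<lambda>z. (-1) ^ (j - 1)"]
          fraction_over_Q_poly[of "\<lambda>z. z (of_nat j)"] polynomial_over_Q_intros)
  then have "fraction_over_Q ?U (\<lambda>u. if b then t j u else 0)" for b j
    using fraction_over_Q_poly[OF polynomial_over_Q_consts(1), of ?U] by (cases b) simp_all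
  then have "regular_over_Q ?U (F I)" for I
    unfolding F_def[abs_def] by (intro fraction_over_Q_imp_regular fraction_over_Q_sum)
  moreover have "pullback (slice \<alpha> \<alpha>s) (Omega f) u v =
      (\<Sum>I | length I = 6. F I u * wedge (map (\<lambda>i w. w $ i) I) v)" for u v
  proof -
    let ?W = "\<lambda>I. wedge (map (\<lambda>i w. w $ i) I) v"
    have fin: "finite {I :: 7 list. length I = 6}"
      using finite_lists_length_eq[of "UNIV :: 7 set" 6] by simp
    have "(slice \<alpha> \<alpha>s has_derivative (\<lambda>w. (w, 0, 0))) (at u)"
      unfolding slice_def[abs_def] by (intro has_derivative_Pair has_derivative_ident has_derivative_const)
    \<comment> \<open>The slice is an affine inclusion, so pulling back is plain
      restriction.\<close>
    from frechet_derivative_at[OF this]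
    have fd: "frechet_derivative (slice \<alpha> \<alpha>s) (at u) = (\<lambda>w. (w, 0, 0))" by simp
    have W: "wedge (map (\<lambda>i w. fst w $ of_nat i) js) (\<lambda>i. (v i, 0 :: complex, 0 :: complex^4)) = ?W (map of_nat js)" for js
      unfolding wedge_compose[where F="\<lambda>w. (w, 0 :: complex, 0 :: complex^4)"] by (simp add: comp_def)
    have "pullback (slice \<alpha> \<alpha>s) (Omega f) u v = (\<Sum>j=1..6. t j u * ?W (?J j))"
      unfolding pullback_def Omega_def sigma5_tilde_def fd W
      by (simp add: slice_def t_def sum_distrib_left of_rat_divide mult_ac)
    \<comment> \<open>Each wedge is spread over all lists by a Kronecker delta, after which the sums
      can be exchanged.\<close>
    also have "\<dots> = (\<Sum>j=1..6. \<Sum>I | length I = 6. if I = ?J j then t j u * ?W I else 0)"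
      using len by (intro sum.cong refl) (simp add: sum.delta[OF fin])
    also have "\<dots> = (\<Sum>I | length I = 6. \<Sum>j=1..6. if I = ?J j then t j u * ?W I else 0)"
      by (rule sum.swap)
    also have "\<dots> = (\<Sum>I | length I = 6. F I u * ?W I)"
      unfolding F_def sum_distrib_right by (intro sum.cong refl) simp
    finally show ?thesis .
  qed
  ultimately show ?thesis
    unfolding algebraic_form_over_Q_def using zariski_open_complement[OF assms(2)] by blast
qed

section \<open>The coefficient, the change of variables and the slices combined\<close>

theorem theorem5p1:
  shows "\<exists>f :: rw_point \<Rightarrow> complex. is_rw_coefficient f \<and>
    (\<forall>T a. is_interval T \<and> smooth_on_open T a \<and> (\<forall>t\<in>T. a t > 0) \<longrightarrow>
      (\<forall>x \<xi> v. x$1 \<in> T \<and> 0 < x$2 \<and> x$2 < pi / 2 \<and>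
          0 < x$3 \<and> x$3 < 2 * pi \<and> 0 < x$4 \<and> x$4 < 2 * pi \<and> \<xi> \<noteq> 0 \<longrightarrow>
        b6 a x \<xi> * deta_sigma5 (x, \<xi>) v = pullback (chart a) (Omega f) (x, \<xi>) v)) \<and>
    (\<forall>(\<alpha>::rat) \<alpha>s. \<alpha> \<noteq> 0 \<longrightarrow>
      algebraic_form_over_Q 6 (- (H0 \<union> H1 \<union> CZ (of_rat \<alpha>))) (pullback (slice \<alpha> \<alpha>s) (Omega f)))"
proof -
  obtain f where f: "is_rw_coefficient f"
    and b6: "\<forall>a x \<xi>. regular_point a x \<xi> \<longrightarrow> b6 a x \<xi> = f (chart a (x, \<xi>))"
    using b6_rw_coefficient by blast
  have pull: "b6 a x \<xi> * deta_sigma5 (x, \<xi>) v = pullback (chart a) (Omega f) (x, \<xi>) v"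
    if "regular_point a x \<xi>" for a x \<xi> v
    unfolding pullback_def Omega_def pullback_sigma5_tilde[OF that] b6[rule_format, OF that] ..
  show ?thesis
  proof (intro exI[of _ f] conjI f allI impI algebraic_form_slice, goal_cases)
    case (1 T a x \<xi> v)
    \<comment> \<open>The interval \<open>T\<close> is the open set required by
      \<open>regular_point\<close>.\<close>
    then show ?case by (intro pull) (auto simp: regular_point_def)
  qed
qed

end
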